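(* Let $m>1$ and $p\mid m$. (a) If $p\notin\{1,m\}$, there are no nice $3$-tuples in $G(m,p,3)$. (b) For every $m>1$, nice $3$-tuples exist in $G(m,1,3)$ and in $G(m,m,3)$. (c) Nice $4$-tuples exist in $W=G(m,p,3)$ if and only if $W$ is one of the following groups: (1) $G(m,m,3)$ with $m\neq 3$; (2) $G(m,1,3)$ with $\gcd(m,3)=1$; (3) $G(3k,3,3)$ with $k>1$ (so $m=3k$). In all three cases, for every nice $4$-tuple $[A_1,A_2,A_3,A_4]$ in $W$, the parameter for middle convolution, i.e. the eigenvalue $\lambda\ne 1$ of multiplicity $2$ of $(A_1A_2A_3A_4)^{-1}$, is a root of unity of order $m$.
   Context: $G(m,p,n)$ (with $p\mid m$) is the group of $n\times n$ complex generalized permutation matrices (exactly one nonzero entry in each row and each column) whose nonzero entries are $m$-th roots of unity and such that the product of all nonzero entries is an $(m/p)$-th root of unity. A reflection is an invertible matrix of finite order having exactly one eigenvalue different from $1$, of multiplicity $1$ (pseudo-reflections are allowed). A $T$-tuple $[A_1,\dots,A_T]$ of matrices in a finite complex reflection group $W\subset \mathrm{GL}_n(\mathbb C)$ (considered up to simultaneous conjugation) is called nice if: (1) every $A_i$ is a reflection in $W$; (2) $W=\langle A_1,\dots,A_T\rangle$; (3) $(A_1A_2\cdots A_T)^{-1}$ has an eigenvalue $\lambda\neq 1$ of multiplicity $T-2$ (exactly). *)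

theory Defs
  imports
    "HOL-Algebra.Generated_Groups"
    "Jordan_Normal_Form.Char_Poly"
begin

definition GL :: "nat \<Rightarrow> complex mat monoid" where
  "GL n = units_of (ring_mat TYPE(complex) n ())"

text \<open>
  Multiplicity of an eigenvalue is its algebraic multiplicity. It is only used for elements of finite
  order, where it agrees with the dimension of the eigenspace.
\<close>

definition multiplicity_eigenvalue :: "complex mat \<Rightarrow> complex \<Rightarrow> nat" where
  "multiplicity_eigenvalue A k = Polynomial.order k (char_poly A)"

definition generalized_permutation_mat :: "nat \<Rightarrow> complex mat \<Rightarrow> bool" where
  "generalized_permutation_mat n A \<longleftrightarrow>
     A \<in> carrier_mat n n \<and>
     (\<forall>i<n. \<exists>!j. j < n \<and> A $$ (i, j) \<noteq> 0) \<and>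
     (\<forall>j<n. \<exists>!i. i < n \<and> A $$ (i, j) \<noteq> 0)"

definition nonzero_positions :: "nat \<Rightarrow> complex mat \<Rightarrow> (nat \<times> nat) set" where
  "nonzero_positions n A = {(i, j). i < n \<and> j < n \<and> A $$ (i, j) \<noteq> 0}"

text \<open>The group $G(m,p,n)$; it is only meaningful for $m > 0$ and $p$ dividing $m$.\<close>

definition G_imprim :: "nat \<Rightarrow> nat \<Rightarrow> nat \<Rightarrow> complex mat set" where
  "G_imprim m p n =
     {A. generalized_permutation_mat n A \<and>
         (\<forall>ij \<in> nonzero_positions n A. (A $$ ij) ^ m = 1) \<and>
         (\<Prod>ij \<in> nonzero_positions n A. A $$ ij) ^ (m div p) = 1}"

text \<open>Pseudo-reflections are allowed: the nontrivial eigenvalue need not be $-1$.\<close>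

definition is_reflection :: "nat \<Rightarrow> complex mat \<Rightarrow> bool" where
  "is_reflection n A \<longleftrightarrow>
     A \<in> carrier_mat n n \<and> invertible_mat A \<and>
     (\<exists>k>0. A ^\<^sub>m k = 1\<^sub>m n) \<and>
     (\<exists>\<mu>. {k. eigenvalue A k \<and> k \<noteq> 1} = {\<mu>} \<and> multiplicity_eigenvalue A \<mu> = 1)"

text \<open>
  The parameter for middle convolution of a tuple $[A_1,\dots,A_T]$: an eigenvalue other than $1$ of
  $(A_1 \cdots A_T)^{-1}$ whose multiplicity is exactly $T - 2$, written without subtraction on
  natural numbers.
\<close>

definition mc_parameter :: "nat \<Rightarrow> complex mat list \<Rightarrow> complex \<Rightarrow> bool" where
  "mc_parameter n As l \<longleftrightarrow>
     (let B = inv\<^bsub>GL n\<^esub> (foldr (\<otimes>\<^bsub>GL n\<^esub>) As \<one>\<^bsub>GL n\<^esub>)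
      in l \<noteq> 1 \<and> eigenvalue B l \<and> multiplicity_eigenvalue B l + 2 = length As)"

text \<open>
  Nice $T$-tuples in \<open>W\<close>. Tuples are represented by lists rather than by their classes under
  simultaneous conjugation: existence of a nice tuple, and the parameter of each nice tuple, depend
  only on these classes.
\<close>

definition nice_tuple :: "nat \<Rightarrow> nat \<Rightarrow> complex mat set \<Rightarrow> complex mat list \<Rightarrow> bool" where
  "nice_tuple n T W As \<longleftrightarrow>
     length As = T \<and>
     (\<forall>A \<in> set As. A \<in> W \<and> is_reflection n A) \<and>
     W = generate (GL n) (set As) \<and>
     (\<exists>l. mc_parameter n As l)"

definition root_of_unity_of_order :: "nat \<Rightarrow> complex \<Rightarrow> bool" where
  "root_of_unity_of_order m z \<longleftrightarrow>
     m > 0 \<and> z ^ m = 1 \<and> (\<forall>k. 0 < k \<and> k < m \<longrightarrow> z ^ k \<noteq> 1)"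

end

theory Submission
  imports Defs "HOL-Combinatorics.Permutations" "HOL-Number_Theory.Cong"
begin

text \<open>
  A reflection in $G(m,p,3)$ is either diagonal with one entry $\xi \neq 1$, where $\xi^{m/p} = 1$, or
  a transposition matrix with entries $x, x^{-1}, 1$. A monomial matrix with an eigenvalue $\lambda$
  of multiplicity exactly 2 is either diagonal with entries $\lambda, \lambda, \nu$, or it swaps two
  coordinates with entries of product $\lambda^2$ and fixes the third one with entry $\lambda$. So the
  four reflections of a nice 4-tuple are all transposition matrices in the first case, and three of
  them are in the second one.

  Taking $e$-th powers of entries is multiplicative on monomial matrices. If $\lambda^e = 1$, the
  relation $A_1 A_2 A_3 A_4 B = 1$ with $B$ the inverse of the product becomes a relation of length four
  between transposition matrices, since the remaining factor becomes trivial. Such a relation forces a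
  common fixed vector $a$ with nonzero entries. Hence every $g$ in $G(m,p,3)$ satisfies
  $g_{ij}^e a_j = a_i$ whenever $g_{ij} \neq 0$, and the element $\mathrm{diag}(\zeta, \zeta^{-1}, 1)$
  gives $m \le e$: the order of $\lambda$ is $m$. Comparing determinants gives $p = m$ in the first
  case, and $\lambda^3 \xi = 1$ with $\xi$ of order $m/p$ in the second one, hence $p = \gcd(m,3)$.
  For triples the same argument with $e = m/p$ applies to two transposition matrices and a diagonal
  reflection.
\<close>

section \<open>Monomial matrices\<close>

text \<open>The equation \<open>g_ij^e a_j = a_i\<close> says that conjugation by diag(a) turns the
  entrywise e-th power of g into a permutation matrix. Two distinct transpositions of three points
  form a path, and along a path such an a can always be solved for. A further transposition matrix
  closes a cycle and is a genuine constraint; the relation of length four is what guarantees that it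
  is met.

  The bound m \<le> e is obtained for every positive e with \<lambda>^e = 1, and \<lambda>^m = 1
  holds because \<lambda> is itself an entry of a matrix in the group, so the order is exactly m.

  The group is never enumerated. Nonexistence uses only subgroups that contain the generators, and
  existence uses only that an arbitrary subgroup containing the tuple contains the group.

  The explicit quadruples run the analysis backwards with \<lambda> = z^-1 for a primitive m-th root
  z. In the diagonal case the inverse product is diag(z^-1, z^2, z^-1), which has a double
  eigenvalue precisely because z^3 \<noteq> 1. In the other case \<lambda>^3 \<xi> = 1 leaves only
  \<xi> = z^3, and the condition on p is that z^3 generates the (m/p)-th roots of unity.\<close>

definition monomial_mat :: "nat \<Rightarrow> (nat \<Rightarrow> nat) \<Rightarrow> (nat \<Rightarrow> complex) \<Rightarrow> complex mat" where
  "monomial_mat n s v = mat n n (\<lambda>(i, j). if j = s i then v i else 0)"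

lemma monomial_mat_carrier [simp]: "monomial_mat n s v \<in> carrier_mat n n"
  by (simp add: monomial_mat_def)

lemma monomial_mat_index:
  "i < n \<Longrightarrow> j < n \<Longrightarrow> monomial_mat n s v $$ (i, j) = (if j = s i then v i else 0)"
  by (simp add: monomial_mat_def)

lemma monomial_mat_cong:
  "(\<And>i. i < n \<Longrightarrow> s i = t i) \<Longrightarrow> (\<And>i. i < n \<Longrightarrow> v i = w i) \<Longrightarrow>
    monomial_mat n s v = monomial_mat n t w"
  by (auto simp: monomial_mat_def intro!: cong_mat)

lemma permutes_lessThan_less: "s permutes {..<n} \<Longrightarrow> i < n \<Longrightarrow> s i < (n :: nat)"
  using permutes_in_image by fastforce

lemma permutes_lessThan_eqI:
  assumes "s permutes {..<n}" "t permutes {..<n}" "\<And>i. i < (n :: nat) \<Longrightarrow> s i = t i"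
  shows "s = t"
  using assms by (metis ext lessThan_iff permutes_not_in)

text \<open>Row i of the second matrix vanishes in column \<open>s i\<close> unless
  \<open>t i = s i\<close>, so nonvanishing of the entries of one side is what makes the permutation
  readable from the matrix.\<close>

lemma monomial_mat_eqD:
  assumes "monomial_mat n s v = monomial_mat n t w"
    and "s permutes {..<n}" "t permutes {..<n}" "\<And>i. i < n \<Longrightarrow> v i \<noteq> 0"
  shows "s = t" and "i < n \<Longrightarrow> v i = w i"
proof -
  have *: "v i = (if s i = t i then w i else 0)" if "i < n" for i
  proof -
    have "monomial_mat n s v $$ (i, s i) = monomial_mat n t w $$ (i, s i)"
      using assms(1) by simp
    then show ?thesis
      using that assms(2) by (simp add: monomial_mat_index permutes_lessThan_less)
  qed
  show "s = t"
    using assms(2,3)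
  proof (rule permutes_lessThan_eqI)
    show "s i = t i" if "i < n" for i
      using *[OF that] assms(4)[OF that] by (auto split: if_splits)
  qed
  then show "v i = w i" if "i < n"
    using *[OF that] by simp
qed

text \<open>Row i carries its entry in column \<open>s i\<close>, so a product of matrices runs
  through the permutations from left to right: the composition appears in reversed order, and the
  second entry is taken at \<open>s i\<close>.\<close>

lemma monomial_mat_mult:
  assumes "s permutes {..<n}"
  shows "monomial_mat n s v * monomial_mat n t w = monomial_mat n (t \<circ> s) (\<lambda>i. v i * w (s i))"
proof (rule eq_matI)
  fix i j
  assume "i < dim_row (monomial_mat n (t \<circ> s) (\<lambda>i. v i * w (s i)))"
    and "j < dim_col (monomial_mat n (t \<circ> s) (\<lambda>i. v i * w (s i)))"
  then have ij: "i < n" "j < n"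
    by (auto simp: monomial_mat_def)
  have "(monomial_mat n s v * monomial_mat n t w) $$ (i, j) =
      (\<Sum>k = 0..<n. (if k = s i then v i else 0) * (if j = t k then w k else 0))"
    using ij by (simp add: monomial_mat_def scalar_prod_def)
  also have "\<dots> = (\<Sum>k = 0..<n. if k = s i then v i * (if j = t k then w k else 0) else 0)"
    by (rule sum.cong) auto
  also have "\<dots> = v i * (if j = t (s i) then w (s i) else 0)"
    using permutes_lessThan_less[OF assms ij(1)] by (subst sum.delta) auto
  finally show "(monomial_mat n s v * monomial_mat n t w) $$ (i, j) =
      monomial_mat n (t \<circ> s) (\<lambda>i. v i * w (s i)) $$ (i, j)"
    using ij by (simp add: monomial_mat_index)
qed (auto simp: monomial_mat_def)

lemma monomial_mat_one: "1\<^sub>m n = monomial_mat n id (\<lambda>i. 1)"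
  by (auto simp: monomial_mat_def)

definition monomial_inv :: "(nat \<Rightarrow> nat) \<Rightarrow> (nat \<Rightarrow> complex) \<Rightarrow> nat \<Rightarrow> complex" where
  "monomial_inv s v = (\<lambda>i. inverse (v (inv_into UNIV s i)))"

lemma monomial_mat_inverse:
  assumes "s permutes {..<n}" "\<And>i. i < n \<Longrightarrow> v i \<noteq> 0"
  shows "monomial_mat n s v * monomial_mat n (inv_into UNIV s) (monomial_inv s v) = 1\<^sub>m n"
    and "monomial_mat n (inv_into UNIV s) (monomial_inv s v) * monomial_mat n s v = 1\<^sub>m n"
proof -
  show "monomial_mat n s v * monomial_mat n (inv_into UNIV s) (monomial_inv s v) = 1\<^sub>m n"
    unfolding monomial_mat_mult[OF assms(1)] monomial_mat_one
    using assms by (intro monomial_mat_cong) (auto simp: monomial_inv_def permutes_inverses)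
  have "inv_into UNIV s i < n" if "i < n" for i
    using permutes_lessThan_less[OF permutes_inv[OF assms(1)] that] .
  then show "monomial_mat n (inv_into UNIV s) (monomial_inv s v) * monomial_mat n s v = 1\<^sub>m n"
    unfolding monomial_mat_mult[OF permutes_inv[OF assms(1)]] monomial_mat_one
    using assms by (intro monomial_mat_cong) (auto simp: monomial_inv_def permutes_inverses)
qed

section \<open>The general linear group and its subgroups given by monomial data\<close>

lemma GL_simps: "x \<otimes>\<^bsub>GL n\<^esub> y = x * y" "\<one>\<^bsub>GL n\<^esub> = 1\<^sub>m n"
  by (simp_all add: GL_def units_of_mult units_of_one ring_mat_simps)

lemma group_GL: "group (GL n)"
proof -
  interpret ring "ring_mat TYPE(complex) n ()"
    by (rule ring_mat)
  show ?thesis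
    unfolding GL_def by (rule units_group)
qed

lemma monomial_mat_in_GL:
  assumes "s permutes {..<n}" "\<And>i. i < n \<Longrightarrow> v i \<noteq> 0"
  shows "monomial_mat n s v \<in> carrier (GL n)"
  unfolding GL_def units_of_carrier Units_def ring_mat_simps
  using monomial_mat_inverse[of s n v] assms by (auto intro!: bexI[of _ "monomial_mat n (inv_into UNIV s) (monomial_inv s v)"])

lemma monomial_inv_nonzero:
  "s permutes {..<n} \<Longrightarrow> (\<And>i. i < n \<Longrightarrow> v i \<noteq> 0) \<Longrightarrow> i < n \<Longrightarrow> monomial_inv s v i \<noteq> 0"
  using permutes_lessThan_less[OF permutes_inv] by (simp add: monomial_inv_def)

lemma GL_inv_monomial_mat:
  assumes "s permutes {..<n}" "\<And>i. i < n \<Longrightarrow> v i \<noteq> 0"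
  shows "inv\<^bsub>GL n\<^esub> (monomial_mat n s v) = monomial_mat n (inv_into UNIV s) (monomial_inv s v)"
  using assms monomial_inv_nonzero[OF assms] permutes_inv[OF assms(1)] monomial_mat_inverse[OF assms]
  by (intro group.inv_equality[OF group_GL]) (auto simp: GL_simps intro!: monomial_mat_in_GL)

text \<open>Every invariant used against a generating tuple is a set of this form. The function v is
  determined by the matrix only below n, so Q has to be recovered for some representative that
  agrees there.\<close>

definition monomial_set :: "nat \<Rightarrow> ((nat \<Rightarrow> nat) \<Rightarrow> (nat \<Rightarrow> complex) \<Rightarrow> bool) \<Rightarrow> complex mat set" where
  "monomial_set n Q = {monomial_mat n s v | s v. s permutes {..<n} \<and> (\<forall>i<n. v i \<noteq> 0) \<and> Q s v}"

lemma subgroup_monomial_set: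
  assumes one: "Q id (\<lambda>i. 1)"
    and mult: "\<And>s v t w. s permutes {..<n} \<Longrightarrow> t permutes {..<n} \<Longrightarrow> Q s v \<Longrightarrow> Q t w \<Longrightarrow>
      Q (t \<circ> s) (\<lambda>i. v i * w (s i))"
    and inverse: "\<And>s v. s permutes {..<n} \<Longrightarrow> (\<forall>i<n. v i \<noteq> 0) \<Longrightarrow> Q s v \<Longrightarrow> Q (inv_into UNIV s) (monomial_inv s v)"
  shows "subgroup (monomial_set n Q) (GL n)"
proof
  show "monomial_set n Q \<subseteq> carrier (GL n)"
    unfolding monomial_set_def using monomial_mat_in_GL by blast
  show "x \<otimes>\<^bsub>GL n\<^esub> y \<in> monomial_set n Q" if xy: "x \<in> monomial_set n Q" "y \<in> monomial_set n Q" for x y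
  proof -
    obtain s v where s: "x = monomial_mat n s v" "s permutes {..<n}" "\<forall>i<n. v i \<noteq> 0" "Q s v"
      using xy(1) by (auto simp: monomial_set_def)
    obtain t w where t: "y = monomial_mat n t w" "t permutes {..<n}" "\<forall>i<n. w i \<noteq> 0" "Q t w"
      using xy(2) by (auto simp: monomial_set_def)
    have "x \<otimes>\<^bsub>GL n\<^esub> y = monomial_mat n (t \<circ> s) (\<lambda>i. v i * w (s i))"
      using s t by (simp add: GL_simps monomial_mat_mult)
    moreover have "t \<circ> s permutes {..<n}" "\<forall>i<n. v i * w (s i) \<noteq> 0"
      using s t by (auto simp: permutes_compose permutes_lessThan_less)
    ultimately show ?thesis
      unfolding monomial_set_def using mult[OF s(2) t(2) s(4) t(4)] by blast
  qed
  show "\<one>\<^bsub>GL n\<^esub> \<in> monomial_set n Q"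
    unfolding monomial_set_def GL_simps monomial_mat_one using one permutes_id by force
  show "inv\<^bsub>GL n\<^esub> x \<in> monomial_set n Q" if x: "x \<in> monomial_set n Q" for x
  proof -
    obtain s v where s: "x = monomial_mat n s v" "s permutes {..<n}" "\<forall>i<n. v i \<noteq> 0" "Q s v"
      using x by (auto simp: monomial_set_def)
    have "inv\<^bsub>GL n\<^esub> x = monomial_mat n (inv_into UNIV s) (monomial_inv s v)"
      using s by (simp add: GL_inv_monomial_mat)
    moreover have "inv_into UNIV s permutes {..<n}" "\<forall>i<n. monomial_inv s v i \<noteq> 0"
      using s monomial_inv_nonzero[of s n v] by (auto simp: permutes_inv)
    ultimately show ?thesis
      unfolding monomial_set_def using inverse[OF s(2-4)] by blast
  qed
qed

lemma prod_permutes_lessThan: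
  "s permutes {..<n} \<Longrightarrow> (\<Prod>i<n. f (s i)) = (\<Prod>i<n. f i)" for f :: "nat \<Rightarrow> complex"
  using prod.permute[of s "{..<n}" f] by (simp add: o_def)

lemma prod_monomial_inv:
  "s permutes {..<n} \<Longrightarrow> (\<Prod>i<n. monomial_inv s v i) = inverse (\<Prod>i<n. v i)"
  using prod_permutes_lessThan[OF permutes_inv, of s n "\<lambda>i. inverse (v i)"]
  by (simp add: monomial_inv_def prod_inversef[symmetric] o_def)

text \<open>The product of the entries is the determinant without the sign of the permutation. It is
  multiplicative by itself because permuting the factors does not change a product.\<close>

lemma subgroup_monomial_det:
  "subgroup (monomial_set n (\<lambda>s v. (\<Prod>i<n. v i) ^ q = 1)) (GL n)"
  by (rule subgroup_monomial_set)
    (simp_all add: prod.distrib prod_permutes_lessThan power_mult_distrib prod_monomial_inv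
      power_inverse)

lemma subgroup_monomial_stabilizer:
  "subgroup (monomial_set n (\<lambda>s v. s c = c)) (GL n)"
  by (rule subgroup_monomial_set) (simp_all add: permutes_inv_eq)

text \<open>Taking e-th powers of all entries is a homomorphism on monomial matrices, and this set
  is the preimage of the stabilizer of the vector a.\<close>

lemma subgroup_monomial_fixed_vector:
  "subgroup (monomial_set n (\<lambda>s v. \<forall>i<n. v i ^ e * a (s i) = a i)) (GL n)"
proof (rule subgroup_monomial_set)
  fix s t :: "nat \<Rightarrow> nat" and v w :: "nat \<Rightarrow> complex"
  assume "s permutes {..<n}" "t permutes {..<n}" "\<forall>i<n. v i ^ e * a (s i) = a i" "\<forall>i<n. w i ^ e * a (t i) = a i"
  then show "\<forall>i<n. (v i * w (s i)) ^ e * a ((t \<circ> s) i) = a i"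
    by (simp add: power_mult_distrib permutes_lessThan_less mult.assoc)
next
  fix s :: "nat \<Rightarrow> nat" and v :: "nat \<Rightarrow> complex"
  assume s: "s permutes {..<n}" and v: "\<forall>i<n. v i \<noteq> (0 :: complex)" and a: "\<forall>i<n. v i ^ e * a (s i) = a i"
  show "\<forall>i<n. monomial_inv s v i ^ e * a (inv_into UNIV s i) = a i"
  proof (intro allI impI)
    fix i assume "i < n"
    then have "inv_into UNIV s i < n"
      using s permutes_inv permutes_lessThan_less by blast
    then have "v (inv_into UNIV s i) ^ e * a i = a (inv_into UNIV s i)" "v (inv_into UNIV s i) \<noteq> 0"
      using a v s by (force simp: permutes_inverses)+
    then show "monomial_inv s v i ^ e * a (inv_into UNIV s i) = a i"
      by (metis (no_types, lifting) left_inverse monomial_inv_def mult.assoc mult.left_neutral power_inverse power_not_zero)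
  qed
qed simp

section \<open>The groups G(m,p,n) as sets of permutations with entries\<close>

lemma generalized_permutation_mat_iff:
  "generalized_permutation_mat n A \<longleftrightarrow>
    (\<exists>s v. s permutes {..<n} \<and> (\<forall>i<n. v i \<noteq> 0) \<and> A = monomial_mat n s v)"
proof
  assume A: "generalized_permutation_mat n A"
  \<comment> \<open>The value i outside the range is what \<open>permutes\<close> requires.\<close>
  define s where "s i = (if i < n then (THE j. j < n \<and> A $$ (i, j) \<noteq> 0) else i)" for i
  have row: "\<And>i. i < n \<Longrightarrow> \<exists>!j. j < n \<and> A $$ (i, j) \<noteq> 0"
    and col: "\<And>j. j < n \<Longrightarrow> \<exists>!i. i < n \<and> A $$ (i, j) \<noteq> 0"
    and carr: "A \<in> carrier_mat n n"
    using A by (auto simp: generalized_permutation_mat_def)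
  have s: "s i < n" "A $$ (i, s i) \<noteq> 0" if "i < n" for i
    using theI'[OF row[OF that]] that by (auto simp: s_def)
  have s_eq: "j = s i" if "i < n" "j < n" "A $$ (i, j) \<noteq> 0" for i j
    using row[OF that(1)] s[OF that(1)] that(2,3) by auto
  have "bij_betw s {..<n} {..<n}"
  proof (rule bij_betw_imageI)
    show "inj_on s {..<n}"
    proof (rule inj_onI)
      fix x y assume "x \<in> {..<n}" "y \<in> {..<n}" "s x = s y"
      then show "x = y"
        using col[OF s(1)[of x]] s(2)[of x] s(2)[of y] by auto
    qed
    then show "s ` {..<n} = {..<n}"
      using s by (intro endo_inj_surj) auto
  qed
  then have "s permutes {..<n}"
    by (rule bij_imp_permutes) (simp add: s_def)
  moreover have "A = monomial_mat n s (\<lambda>i. A $$ (i, s i))"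
    by (rule eq_matI) (use carr s_eq in \<open>auto simp: monomial_mat_def\<close>)
  ultimately show "\<exists>s v. s permutes {..<n} \<and> (\<forall>i<n. v i \<noteq> 0) \<and> A = monomial_mat n s v"
    using s by (intro exI[of _ s] exI[of _ "\<lambda>i. A $$ (i, s i)"]) auto
next
  assume "\<exists>s v. s permutes {..<n} \<and> (\<forall>i<n. v i \<noteq> 0) \<and> A = monomial_mat n s v"
  then obtain s v where s: "s permutes {..<n}" and v: "\<forall>i<n. v i \<noteq> 0" and A: "A = monomial_mat n s v"
    by blast
  show "generalized_permutation_mat n A"
    unfolding generalized_permutation_mat_def
  proof (intro conjI allI impI)
    show "A \<in> carrier_mat n n"
      by (simp add: A)
    show "\<exists>!j. j < n \<and> A $$ (i, j) \<noteq> 0" if "i < n" for i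
      using that v permutes_lessThan_less[OF s that] by (intro ex1I[of _ "s i"]) (auto simp: A monomial_mat_index split: if_splits)
    show "\<exists>!i. i < n \<and> A $$ (i, j) \<noteq> 0" if "j < n" for j
      using that v permutes_lessThan_less[OF permutes_inv[OF s] that] s
      by (intro ex1I[of _ "inv_into UNIV s j"]) (auto simp: A monomial_mat_index permutes_inverses split: if_splits)
  qed
qed

lemma nonzero_positions_monomial_mat:
  assumes "s permutes {..<n}" "\<forall>i<n. v i \<noteq> 0"
  shows "nonzero_positions n (monomial_mat n s v) = (\<lambda>i. (i, s i)) ` {..<n}"
  using assms by (auto simp: nonzero_positions_def monomial_mat_index permutes_lessThan_less split: if_splits)

lemma G_imprim_eq_monomial_set:
  "G_imprim m p n = monomial_set n (\<lambda>s v. (\<forall>i<n. v i ^ m = 1) \<and> (\<Prod>i<n. v i) ^ (m div p) = 1)"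
proof -
  have 1: "(\<forall>ij \<in> nonzero_positions n (monomial_mat n s v). (monomial_mat n s v $$ ij) ^ m = 1) \<longleftrightarrow>
      (\<forall>i<n. v i ^ m = 1)"
    and 2: "(\<Prod>ij \<in> nonzero_positions n (monomial_mat n s v). monomial_mat n s v $$ ij) = (\<Prod>i<n. v i)"
    if "s permutes {..<n}" "\<forall>i<n. v i \<noteq> 0" for s v
  proof -
    show "(\<forall>ij \<in> nonzero_positions n (monomial_mat n s v). (monomial_mat n s v $$ ij) ^ m = 1) \<longleftrightarrow>
      (\<forall>i<n. v i ^ m = 1)"
      unfolding nonzero_positions_monomial_mat[OF that]
      using that by (auto simp: monomial_mat_index permutes_lessThan_less)
    have "inj_on (\<lambda>i. (i, s i)) {..<n}"
      by (auto intro: inj_onI)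
    then show "(\<Prod>ij \<in> nonzero_positions n (monomial_mat n s v). monomial_mat n s v $$ ij) = (\<Prod>i<n. v i)"
      unfolding nonzero_positions_monomial_mat[OF that]
      using that by (auto simp: prod.reindex monomial_mat_index permutes_lessThan_less intro!: prod.cong)
  qed
  show ?thesis
  proof (intro equalityI subsetI)
    fix A assume A: "A \<in> G_imprim m p n"
    then obtain s v where s: "s permutes {..<n}" "\<forall>i<n. v i \<noteq> 0" "A = monomial_mat n s v"
      by (auto simp: G_imprim_def generalized_permutation_mat_iff)
    show "A \<in> monomial_set n (\<lambda>s v. (\<forall>i<n. v i ^ m = 1) \<and> (\<Prod>i<n. v i) ^ (m div p) = 1)"
      using A s 1[OF s(1,2)] 2[OF s(1,2)] unfolding G_imprim_def monomial_set_def
      by (intro CollectI exI[of _ s] exI[of _ v]) simp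
  next
    fix A assume "A \<in> monomial_set n (\<lambda>s v. (\<forall>i<n. v i ^ m = 1) \<and> (\<Prod>i<n. v i) ^ (m div p) = 1)"
    then obtain s v where s: "s permutes {..<n}" "\<forall>i<n. v i \<noteq> 0" "A = monomial_mat n s v"
      and v: "\<forall>i<n. v i ^ m = 1" "(\<Prod>i<n. v i) ^ (m div p) = 1"
      by (auto simp: monomial_set_def)
    have "generalized_permutation_mat n A"
      using s by (auto simp: generalized_permutation_mat_iff)
    then show "A \<in> G_imprim m p n"
      using s v 1[OF s(1,2)] 2[OF s(1,2)] unfolding G_imprim_def by simp
  qed
qed

lemma subgroup_G_imprim: "subgroup (G_imprim m p n) (GL n)"
  unfolding G_imprim_eq_monomial_set
proof (rule subgroup_monomial_set)
  fix s t :: "nat \<Rightarrow> nat" and v w :: "nat \<Rightarrow> complex"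
  assume "s permutes {..<n}" "t permutes {..<n}" "(\<forall>i<n. v i ^ m = 1) \<and> (\<Prod>i<n. v i) ^ (m div p) = 1"
    "(\<forall>i<n. w i ^ m = 1) \<and> (\<Prod>i<n. w i) ^ (m div p) = 1"
  then show "(\<forall>i<n. (v i * w (s i)) ^ m = 1) \<and> (\<Prod>i<n. v i * w (s i)) ^ (m div p) = 1"
    by (simp add: prod.distrib prod_permutes_lessThan power_mult_distrib permutes_lessThan_less)
next
  fix s :: "nat \<Rightarrow> nat" and v :: "nat \<Rightarrow> complex"
  assume s: "s permutes {..<n}" and "(\<forall>i<n. v i ^ m = 1) \<and> (\<Prod>i<n. v i) ^ (m div p) = 1"
  then show "(\<forall>i<n. monomial_inv s v i ^ m = 1) \<and> (\<Prod>i<n. monomial_inv s v i) ^ (m div p) = 1"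
    using permutes_lessThan_less[OF permutes_inv[OF s]]
    by (simp add: prod_monomial_inv power_inverse) (simp add: monomial_inv_def power_inverse)
qed simp

section \<open>Eigenvalues of monomial matrices of size 3\<close>

lemma det_3:
  fixes A :: "'a :: comm_ring_1 mat"
  assumes "A \<in> carrier_mat 3 3"
  shows "det A =
    A $$ (0, 0) * (A $$ (1, 1) * A $$ (2, 2) - A $$ (1, 2) * A $$ (2, 1)) +
    A $$ (0, 1) * (A $$ (1, 2) * A $$ (2, 0) - A $$ (1, 0) * A $$ (2, 2)) +
    A $$ (0, 2) * (A $$ (1, 0) * A $$ (2, 1) - A $$ (1, 1) * A $$ (2, 0))"
proof -
  have det_2: "det M = M $$ (0, 0) * M $$ (1, 1) - M $$ (0, 1) * M $$ (1, 0)"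
    if M: "M \<in> carrier_mat 2 2" for M :: "'a mat"
  proof -
    have "cofactor M 0 0 = M $$ (1, 1)" "cofactor M 0 1 = - M $$ (1, 0)"
      unfolding cofactor_def using M by (subst det_single; simp add: mat_delete_def)+
    then show ?thesis
      using laplace_expansion_row[OF M, of 0] by (simp add: numeral_2_eq_2)
  qed
  have "cofactor A 0 0 = A $$ (1, 1) * A $$ (2, 2) - A $$ (1, 2) * A $$ (2, 1)"
    "cofactor A 0 1 = A $$ (1, 2) * A $$ (2, 0) - A $$ (1, 0) * A $$ (2, 2)"
    "cofactor A 0 2 = A $$ (1, 0) * A $$ (2, 1) - A $$ (1, 1) * A $$ (2, 0)"
    unfolding cofactor_def using assms
    by (subst det_2; simp add: mat_delete_def numeral_2_eq_2)+
  then show ?thesis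
    using laplace_expansion_row[OF assms, of 0] by (simp add: numeral_3_eq_3 numeral_2_eq_2)
qed

lemma less_3_cases: "(\<forall>i<3. P i) \<longleftrightarrow> P 0 \<and> P 1 \<and> P (2 :: nat)"
  by (auto simp: numeral_3_eq_3 numeral_2_eq_2 less_Suc_eq)

lemma ex_less_3: "(\<exists>i<3. P i) \<longleftrightarrow> P 0 \<or> P 1 \<or> P (2 :: nat)"
  by (auto simp: numeral_3_eq_3 numeral_2_eq_2 less_Suc_eq)

lemma less_3_iff: "(i :: nat) < 3 \<longleftrightarrow> i = 0 \<or> i = 1 \<or> i = 2"
  by auto

lemma prod_lessThan_3: "(\<Prod>i<3. f i) = f 0 * f 1 * f (2 :: nat)" for f :: "nat \<Rightarrow> complex"
  by (simp add: numeral_3_eq_3 numeral_2_eq_2)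

text \<open>Listing the roots of the characteristic polynomial with repetition yields the
  eigenvalues and their algebraic multiplicities from one statement, without case distinctions on
  coincidences among a, b, c.\<close>

definition char_roots :: "complex mat \<Rightarrow> complex \<Rightarrow> complex \<Rightarrow> complex \<Rightarrow> bool" where
  "char_roots A a b c \<longleftrightarrow> A \<in> carrier_mat 3 3 \<and> char_poly A = [:-a, 1:] * [:-b, 1:] * [:-c, 1:]"

lemma char_roots_eigenvalue:
  "char_roots A a b c \<Longrightarrow> eigenvalue A k \<longleftrightarrow> k = a \<or> k = b \<or> k = c"
  unfolding char_roots_def
  by (simp only: eigenvalue_root_char_poly[of A 3] poly_mult mult_eq_0_iff) (auto simp: algebra_simps)

lemma char_roots_multiplicity:
  assumes "char_roots A a b c"
  shows "multiplicity_eigenvalue A k = of_bool (k = a) + of_bool (k = b) + of_bool (k = c)"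
proof -
  have lin: "Polynomial.order k [:-x, 1:] = of_bool (k = x)" for x :: complex
  proof (cases "k = x")
    case True
    have "Polynomial.order k ([:-x, 1:] ^ 1) = 1"
      unfolding True by (rule order_power_n_n)
    then show ?thesis
      using True by simp
  next
    case False
    then show ?thesis
      by (simp add: order_0I)
  qed
  have ne: "[:-a, 1:] * [:-b, 1:] \<noteq> 0" "[:-a, 1:] * [:-b, 1:] * [:-c, 1:] \<noteq> 0"
    by (metis mult_eq_0_iff one_neq_zero pCons_eq_0_iff)+
  then show ?thesis
    using assms unfolding char_roots_def multiplicity_eigenvalue_def
    by (simp only: Polynomial.order_mult[OF ne(1)] Polynomial.order_mult[OF ne(2)] lin)
qed

lemma char_poly_monomial_mat_3:
  assumes "s permutes {..<3}"
  shows "char_poly (monomial_mat 3 s v) =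
    (let e = (\<lambda>i j. [:if j = s i then - v i else 0, if i = j then 1 else 0:]) in
      e 0 0 * (e 1 1 * e 2 2 - e 1 2 * e 2 1) + e 0 1 * (e 1 2 * e 2 0 - e 1 0 * e 2 2) +
      e 0 2 * (e 1 0 * e 2 1 - e 1 1 * e 2 0))"
proof -
  have "char_poly_matrix (monomial_mat 3 s v) $$ (i, j) =
      [:if j = s i then - v i else 0, if i = j then 1 else 0:]" if "i < 3" "j < 3" for i j
    using that by (simp add: char_poly_matrix_def monomial_mat_def)
  then show ?thesis
    unfolding char_poly_def by (subst det_3) (simp_all add: Let_def)
qed

lemma char_roots_diagonal: "char_roots (monomial_mat 3 id v) (v 0) (v 1) (v 2)"
  unfolding char_roots_def by (simp add: char_poly_monomial_mat_3[OF permutes_id] Let_def algebra_simps)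

text \<open>The block on the two swapped coordinates has characteristic polynomial x^2 -
  \<open>v i * v j\<close>, whose roots are opposite to each other.\<close>

lemma char_roots_transpose:
  assumes "i < 3" "j < 3" "k < 3" "distinct [i, j, k]" and r: "r\<^sup>2 = v i * v j"
  shows "char_roots (monomial_mat 3 (Transposition.transpose i j) v) r (- r) (v k)"
proof -
  have "Transposition.transpose i j permutes {..<3}"
    using assms by (intro permutes_swap_id) auto
  then show ?thesis
    using assms unfolding char_roots_def less_3_iff
    by (elim disjE) (auto simp: char_poly_monomial_mat_3 Let_def Transposition.transpose_def algebra_simps power2_eq_square)
qed

lemma cube_root_of_unity:
  assumes "(w :: complex)\<^sup>2 = - 1 - w"
  shows "w ^ 3 = 1"
proof -
  have "w ^ 3 = w * w\<^sup>2"
    by (simp add: power3_eq_cube power2_eq_square)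
  also have "\<dots> = w * (- 1 - w)"
    using assms by simp
  also have "\<dots> = - w - w\<^sup>2"
    by (simp add: algebra_simps power2_eq_square)
  also have "\<dots> = 1"
    using assms by simp
  finally show ?thesis .
qed

text \<open>For both 3-cycles the characteristic polynomial is x^3 minus the product of the entries.
  Its roots are the multiples of one cube root r by 1, w, w^2; the middle coefficients vanish since
  1 + w + w^2 = 0.\<close>

lemma char_roots_cycle:
  assumes s: "s permutes {..<3}" "\<forall>i<3. s i \<noteq> i"
    and r: "r ^ 3 = v 0 * v 1 * v 2" and w: "w\<^sup>2 = - 1 - w"
  shows "char_roots (monomial_mat 3 s v) r (w * r) (w\<^sup>2 * r)"
proof -
  have lt: "s 0 < 3" "s 1 < 3" "s 2 < 3"
    using permutes_lessThan_less[OF s(1)] by auto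
  have inj: "s 0 \<noteq> s 1" "s 0 \<noteq> s 2" "s 1 \<noteq> s 2"
    using permutes_inj[OF s(1)] by (auto simp: inj_eq)
  consider "s 0 = 1" "s 1 = 2" "s 2 = 0" | "s 0 = 2" "s 1 = 0" "s 2 = 1"
    using lt inj s(2) unfolding less_3_cases by (auto simp: less_3_iff)
  then have "char_poly (monomial_mat 3 s v) = [:- (v 0 * v 1 * v 2), 0, 0, 1:]"
    by cases (simp_all only: char_poly_monomial_mat_3[OF s(1)] Let_def, simp_all)
  also have "\<dots> = [:-r, 1:] * [:-(w * r), 1:] * [:-(w\<^sup>2 * r), 1:]"
  proof -
    have w3: "w * w\<^sup>2 = 1"
      using cube_root_of_unity[OF w] by (simp add: power3_eq_cube power2_eq_square mult.assoc)
    have 1: "r * (w * r) * (w\<^sup>2 * r) = v 0 * v 1 * v 2"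
      using w3 r by (simp add: power3_eq_cube algebra_simps)
    have 2: "r * (w * r) + r * (w\<^sup>2 * r) + w * r * (w\<^sup>2 * r) = 0"
    proof -
      have "r * (w * r) + r * (w\<^sup>2 * r) + w * r * (w\<^sup>2 * r) = r * r * (w + w\<^sup>2 + w * w\<^sup>2)"
        by (simp add: algebra_simps)
      then show ?thesis
        unfolding w3 using w by simp
    qed
    have 3: "r + w * r + w\<^sup>2 * r = 0"
      unfolding w by (simp add: algebra_simps)
    have expand: "[:-a, 1:] * [:-b, 1:] * [:-c, 1:] = [:- (a * b * c), a * b + a * c + b * c, - (a + b + c), 1:]"
      for a b c :: complex
      by (simp add: algebra_simps)
    show ?thesis
      unfolding expand 1 2 3 by simp
  qed
  finally show ?thesis
    by (simp add: char_roots_def)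
qed

lemma cube_root_of_unity_exists: "\<exists>w :: complex. w\<^sup>2 = - 1 - w"
proof -
  have "poly [:1, 1, 1:] w = 0 \<Longrightarrow> w\<^sup>2 = - 1 - w" for w :: complex
    by (simp add: algebra_simps power2_eq_square add_eq_0_iff)
  moreover have "\<exists>w. poly [:1, 1, 1 :: complex:] w = 0"
    by (rule fundamental_theorem_of_algebra_alt) auto
  ultimately show ?thesis
    by blast
qed

lemma permutes_3_cases:
  assumes "s permutes {..<3 :: nat}"
  obtains "s = id"
  | i j k where "i < 3" "j < 3" "k < 3" "distinct [i, j, k]" "s = Transposition.transpose i j"
  | "\<forall>i<3. s i \<noteq> i"
proof -
  have lt: "s 0 < 3" "s 1 < 3" "s 2 < 3"
    using permutes_lessThan_less[OF assms] by auto
  have inj: "s 0 \<noteq> s 1" "s 0 \<noteq> s 2" "s 1 \<noteq> s 2"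
    using permutes_inj[OF assms] by (auto simp: inj_eq)
  have eqI: "s = t" if "t permutes {..<3}" "s 0 = t 0" "s 1 = t 1" "s 2 = t 2" for t
    using assms that by (intro permutes_lessThan_eqI) (auto simp: less_3_iff)
  have tr: "Transposition.transpose i j permutes {..<3}" if "i < 3" "j < 3" for i j :: nat
    using that by (intro permutes_swap_id) auto
  consider "s 0 = 0" "s 1 = 1" "s 2 = 2" | "s 0 = 0" "s 1 = 2" "s 2 = 1" | "s 0 = 1" "s 1 = 0" "s 2 = 2"
    | "s 0 = 2" "s 1 = 1" "s 2 = 0" | "s 0 \<noteq> 0" "s 1 \<noteq> 1" "s 2 \<noteq> 2"
    using lt inj by (auto simp: less_3_iff)
  then show thesis
  proof cases
    case 1
    then show ?thesis
      using that(1) eqI[OF permutes_id] by simp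
  next
    case 2
    then show ?thesis
      using that(2)[of 1 2 0] eqI[OF tr[of 1 2]] by simp
  next
    case 3
    then show ?thesis
      using that(2)[of 0 1 2] eqI[OF tr[of 0 1]] by simp
  next
    case 4
    then show ?thesis
      using that(2)[of 0 2 1] eqI[OF tr[of 0 2]] by simp
  next
    case 5
    then show ?thesis
      using that(3) by (simp add: less_3_cases)
  qed
qed

section \<open>Reflections and double eigenvalues among monomial matrices of size 3\<close>

definition transposition_reflection :: "(nat \<Rightarrow> nat) \<Rightarrow> (nat \<Rightarrow> complex) \<Rightarrow> bool" where
  "transposition_reflection s v \<longleftrightarrow>
    (\<exists>i j k. i < 3 \<and> j < 3 \<and> k < 3 \<and> distinct [i, j, k] \<and>
      s = Transposition.transpose i j \<and> v i * v j = 1 \<and> v k = 1)"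

definition diagonal_reflection :: "(nat \<Rightarrow> nat) \<Rightarrow> (nat \<Rightarrow> complex) \<Rightarrow> bool" where
  "diagonal_reflection s v \<longleftrightarrow> s = id \<and> (\<exists>k<3. v k \<noteq> 1 \<and> (\<forall>i<3. i \<noteq> k \<longrightarrow> v i = 1))"

lemma of_bool_sum_3_eq_1:
  "of_bool P + of_bool Q + of_bool R = (1 :: nat) \<longleftrightarrow>
    P \<and> \<not> Q \<and> \<not> R \<or> \<not> P \<and> Q \<and> \<not> R \<or> \<not> P \<and> \<not> Q \<and> R"
  by (cases P; cases Q; cases R) simp_all

lemma of_bool_sum_3_eq_2:
  "of_bool P + of_bool Q + of_bool R = (2 :: nat) \<longleftrightarrow>
    \<not> P \<and> Q \<and> R \<or> P \<and> \<not> Q \<and> R \<or> P \<and> Q \<and> \<not> R"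
  by (cases P; cases Q; cases R) simp_all

text \<open>Three distinct eigenvalues rule out 3-cycles both as reflections and as matrices with a
  double eigenvalue. The cubes serve to show that an eigenvalue differs from 1.\<close>

lemma char_roots_cycle_distinct:
  assumes "s permutes {..<3}" "\<forall>i<3. s i \<noteq> i" "\<forall>i<3. v i \<noteq> 0"
  obtains a b c where "char_roots (monomial_mat 3 s v) a b c" "distinct [a, b, c]" "a ^ 3 = v 0 * v 1 * v 2"
    "b ^ 3 = v 0 * v 1 * v 2" "c ^ 3 = v 0 * v 1 * v 2"
proof -
  obtain r where r: "r ^ 3 = v 0 * v 1 * v 2"
    using fundamental_theorem_of_algebra_alt[of "[:- (v 0 * v 1 * v 2), 0, 0, 1:]"]
    by (auto simp: power3_eq_cube algebra_simps)
  obtain w :: complex where w: "w\<^sup>2 = - 1 - w"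
    using cube_root_of_unity_exists by blast
  have "r \<noteq> 0"
    using r assms(3) by auto
  have w3: "w ^ 3 = 1"
    by (rule cube_root_of_unity[OF w])
  have "w \<noteq> 1" "w \<noteq> 0"
    using w by auto
  moreover have "w\<^sup>2 \<noteq> 1"
    using w3 \<open>w \<noteq> 1\<close> by (auto simp: power3_eq_cube power2_eq_square)
  moreover have "w\<^sup>2 \<noteq> w"
    using \<open>w \<noteq> 0\<close> \<open>w \<noteq> 1\<close> by (auto simp: power2_eq_square)
  ultimately have "distinct [r, w * r, w\<^sup>2 * r]"
    using \<open>r \<noteq> 0\<close> by auto
  moreover have "(w * r) ^ 3 = w ^ 3 * r ^ 3" "(w\<^sup>2 * r) ^ 3 = (w ^ 3)\<^sup>2 * r ^ 3"
    by (simp_all add: power_mult_distrib flip: power_mult)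
  ultimately show thesis
    using that char_roots_cycle[OF assms(1,2) r w] r w3 by simp
qed

lemma char_roots_transpose_ex:
  assumes "i < 3" "j < 3" "k < 3" "distinct [i, j, k]" "v i \<noteq> 0" "v j \<noteq> 0"
  obtains r where "r \<noteq> 0" "r\<^sup>2 = v i * v j"
    "char_roots (monomial_mat 3 (Transposition.transpose i j) v) r (- r) (v k)"
proof -
  have "(csqrt (v i * v j))\<^sup>2 = v i * v j"
    by simp
  with that[of "csqrt (v i * v j)"] char_roots_transpose[OF assms(1-4)] assms(5,6) show thesis
    by simp
qed

lemma monomial_reflection_cases:
  assumes "is_reflection 3 (monomial_mat 3 s v)" "s permutes {..<3}" and nz: "\<forall>i<3. v i \<noteq> 0"
  shows "diagonal_reflection s v \<or> transposition_reflection s v"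
proof -
  obtain \<mu> where \<mu>: "{k. eigenvalue (monomial_mat 3 s v) k \<and> k \<noteq> 1} = {\<mu>}"
    "multiplicity_eigenvalue (monomial_mat 3 s v) \<mu> = 1"
    using assms(1) by (auto simp: is_reflection_def)
  have \<mu>_iff: "eigenvalue (monomial_mat 3 s v) k \<and> k \<noteq> 1 \<longleftrightarrow> k = \<mu>" for k
    using \<mu>(1) by blast
  show ?thesis
    using assms(2)
  proof (cases rule: permutes_3_cases)
    case 1
    note r = char_roots_diagonal[of v]
    have *: "(k = v 0 \<or> k = v 1 \<or> k = v 2) \<and> k \<noteq> 1 \<longleftrightarrow> k = \<mu>" for k
      using \<mu>_iff[of k] unfolding 1 char_roots_eigenvalue[OF r] .
    have "of_bool (\<mu> = v 0) + of_bool (\<mu> = v 1) + of_bool (\<mu> = v 2) = (1 :: nat)"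
      using \<mu>(2) unfolding 1 char_roots_multiplicity[OF r] .
    then have "\<exists>k<3. v k \<noteq> 1 \<and> (\<forall>i<3. i \<noteq> k \<longrightarrow> v i = 1)"
      unfolding ex_less_3 less_3_cases of_bool_sum_3_eq_1 using *[of "v 0"] *[of "v 1"] *[of "v 2"]
      by metis
    then show ?thesis
      by (simp add: diagonal_reflection_def 1)
  next
    case (2 i j k)
    obtain r where r: "r \<noteq> 0" "r\<^sup>2 = v i * v j"
      and cr: "char_roots (monomial_mat 3 (Transposition.transpose i j) v) r (- r) (v k)"
      using char_roots_transpose_ex[OF 2(1-4)] nz 2(1,2) by blast
    have *: "(x = r \<or> x = - r \<or> x = v k) \<and> x \<noteq> 1 \<longleftrightarrow> x = \<mu>" for x
      using \<mu>_iff[of x] unfolding 2(5) char_roots_eigenvalue[OF cr] .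
    have **: "of_bool (\<mu> = r) + of_bool (\<mu> = - r) + of_bool (\<mu> = v k) = (1 :: nat)"
      using \<mu>(2) unfolding 2(5) char_roots_multiplicity[OF cr] .
    \<comment> \<open>Otherwise r and -r would be two different eigenvalues distinct from 1.\<close>
    have "r = 1 \<or> r = - 1"
      using *[of r] *[of "- r"] r(1) by (metis add.inverse_inverse add_eq_0_iff double_zero_sym minus_unique mult_2 mult_eq_0_iff zero_neq_numeral)
    then have "r\<^sup>2 = 1" "\<mu> = - 1"
      using *[of r] *[of "- r"] by auto
    \<comment> \<open>The only other possibility is -1, which would then have multiplicity
      2.\<close>
    moreover have "v k = 1"
      using \<open>r = 1 \<or> r = - 1\<close> \<open>\<mu> = - 1\<close> *[of "v k"] ** unfolding of_bool_sum_3_eq_1 by auto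
    ultimately have "transposition_reflection s v"
      unfolding transposition_reflection_def using 2 r(2) by metis
    then show ?thesis ..
  next
    case 3
    obtain a b c where cr: "char_roots (monomial_mat 3 s v) a b c" and d: "distinct [a, b, c]"
      using char_roots_cycle_distinct[OF assms(2) 3 nz] .
    have "(x = a \<or> x = b \<or> x = c) \<and> x \<noteq> 1 \<longleftrightarrow> x = \<mu>" for x
      using \<mu>_iff[of x] unfolding char_roots_eigenvalue[OF cr] .
    with d have False
      by (metis distinct_length_2_or_more)
    then show ?thesis ..
  qed
qed

lemma double_eigenvalue_cases:
  assumes "multiplicity_eigenvalue (monomial_mat 3 s v) l = 2" "s permutes {..<3}"
    and nz: "\<forall>i<3. v i \<noteq> 0"
  obtains k where "s = id" "k < 3" "v k \<noteq> l" "\<forall>i<3. i \<noteq> k \<longrightarrow> v i = l"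
  | i j k where "i < 3" "j < 3" "k < 3" "distinct [i, j, k]" "s = Transposition.transpose i j"
    "v k = l" "v i * v j = l\<^sup>2"
  using assms(2)
proof (cases rule: permutes_3_cases)
  case 1
  have "of_bool (l = v 0) + of_bool (l = v 1) + of_bool (l = v 2) = (2 :: nat)"
    using assms(1) unfolding 1 char_roots_multiplicity[OF char_roots_diagonal] .
  then have "\<exists>k<3. v k \<noteq> l \<and> (\<forall>i<3. i \<noteq> k \<longrightarrow> v i = l)"
    unfolding ex_less_3 less_3_cases of_bool_sum_3_eq_2 by (elim disjE) force+
  then show ?thesis
    using that(1)[OF 1] by blast
next
  case (2 i j k)
  obtain r where r: "r \<noteq> 0" "r\<^sup>2 = v i * v j"
    and cr: "char_roots (monomial_mat 3 (Transposition.transpose i j) v) r (- r) (v k)"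
    using char_roots_transpose_ex[OF 2(1-4)] nz 2(1,2) by blast
  have **: "of_bool (l = r) + of_bool (l = - r) + of_bool (l = v k) = (2 :: nat)"
    using assms(1) unfolding 2(5) char_roots_multiplicity[OF cr] .
  \<comment> \<open>Since r and -r are distinct, a double eigenvalue must be the entry
    \<open>v k\<close> together with exactly one of them.\<close>
  have "r \<noteq> - r"
    using r(1) by auto
  then have "v k = l" "l = r \<or> l = - r"
    using ** unfolding of_bool_sum_3_eq_2 by auto
  then have "l\<^sup>2 = r\<^sup>2"
    by auto
  then show ?thesis
    using that(2)[OF 2] \<open>v k = l\<close> r(2) by simp
next
  case 3
  obtain a b c where cr: "char_roots (monomial_mat 3 s v) a b c" and d: "distinct [a, b, c]"
    using char_roots_cycle_distinct[OF assms(2) 3 nz] .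
  have "of_bool (l = a) + of_bool (l = b) + of_bool (l = c) = (2 :: nat)"
    using assms(1) unfolding char_roots_multiplicity[OF cr] .
  with d have False
    unfolding of_bool_sum_3_eq_2 by auto
  then show ?thesis ..
qed

lemma monomial_mat_invertible:
  assumes "s permutes {..<n}" "\<forall>i<n. v i \<noteq> 0"
  shows "invertible_mat (monomial_mat n s v)"
  using monomial_mat_inverse[of s n v] assms unfolding invertible_mat_def inverts_mat_def
  by (auto simp: monomial_mat_def square_mat.simps)

lemma transposition_reflection_is_reflection:
  assumes "transposition_reflection s v"
  shows "is_reflection 3 (monomial_mat 3 s v)"
proof -
  obtain i j k where ijk: "i < 3" "j < 3" "k < 3" "distinct [i, j, k]"
    and s: "s = Transposition.transpose i j" and v: "v i * v j = 1" "v k = 1"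
    using assms by (auto simp: transposition_reflection_def)
  have perm: "s permutes {..<3}"
    using ijk unfolding s by (intro permutes_swap_id) auto
  have nz: "\<forall>i<3. v i \<noteq> 0"
    using ijk v unfolding less_3_cases by (auto simp: less_3_iff)
  have cr: "char_roots (monomial_mat 3 s v) 1 (- 1) 1"
    using char_roots_transpose[OF ijk, of 1 v] v by (simp add: s)
  have "monomial_mat 3 s v * monomial_mat 3 s v = 1\<^sub>m 3"
    unfolding monomial_mat_mult[OF perm] monomial_mat_one
    using ijk v by (intro monomial_mat_cong) (auto simp: s less_3_iff Transposition.transpose_def mult.commute)
  then have "\<exists>k>0. monomial_mat 3 s v ^\<^sub>m k = 1\<^sub>m 3"
    by (intro exI[of _ 2]) (simp add: numeral_2_eq_2 left_mult_one_mat[of _ 3 3])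
  moreover have "{k. eigenvalue (monomial_mat 3 s v) k \<and> k \<noteq> 1} = {- 1}"
    "multiplicity_eigenvalue (monomial_mat 3 s v) (- 1) = 1"
    unfolding char_roots_eigenvalue[OF cr] char_roots_multiplicity[OF cr] by auto
  ultimately show ?thesis
    unfolding is_reflection_def using monomial_mat_invertible[OF perm nz] by auto
qed

lemma diagonal_reflection_is_reflection:
  assumes "diagonal_reflection s v" "\<forall>i<3. v i ^ m = 1" "m > 0"
  shows "is_reflection 3 (monomial_mat 3 s v)"
proof -
  obtain k where s: "s = id" and k: "k < 3" "v k \<noteq> 1" "\<forall>i<3. i \<noteq> k \<longrightarrow> v i = 1"
    using assms by (auto simp: diagonal_reflection_def)
  have nz: "\<forall>i<3. v i \<noteq> 0"
    using assms(2,3) by (metis power_eq_0_iff zero_neq_one zero_power)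
  have cr: "char_roots (monomial_mat 3 s v) (v 0) (v 1) (v 2)"
    unfolding s by (rule char_roots_diagonal)
  have "monomial_mat 3 id v ^\<^sub>m e = monomial_mat 3 id (\<lambda>i. v i ^ e)" for e
  proof (induction e)
    case 0
    have dim: "dim_row (monomial_mat 3 id v) = 3"
      by (simp add: monomial_mat_def)
    show ?case
      unfolding pow_mat.simps dim monomial_mat_one by (intro monomial_mat_cong) simp_all
  next
    case (Suc e)
    show ?case
      unfolding pow_mat.simps Suc monomial_mat_mult[OF permutes_id] by (intro monomial_mat_cong) auto
  qed
  moreover have "monomial_mat 3 id (\<lambda>i. v i ^ m) = 1\<^sub>m 3"
    unfolding monomial_mat_one using assms(2) by (intro monomial_mat_cong) auto
  ultimately have "\<exists>k>0. monomial_mat 3 s v ^\<^sub>m k = 1\<^sub>m 3"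
    using assms(3) s by auto
  moreover consider "v 1 = 1" "v 2 = 1" "v 0 \<noteq> 1" "v k = v 0" | "v 0 = 1" "v 2 = 1" "v 1 \<noteq> 1" "v k = v 1"
    | "v 0 = 1" "v 1 = 1" "v 2 \<noteq> 1" "v k = v 2"
    using k unfolding less_3_cases less_3_iff by (elim disjE) simp_all
  then have "{x. eigenvalue (monomial_mat 3 s v) x \<and> x \<noteq> 1} = {v k} \<and>
      multiplicity_eigenvalue (monomial_mat 3 s v) (v k) = 1"
    unfolding char_roots_eigenvalue[OF cr] char_roots_multiplicity[OF cr] by cases auto
  ultimately show ?thesis
    unfolding is_reflection_def using monomial_mat_invertible[of s 3 v] nz s permutes_id by auto
qed

section \<open>Common fixed vectors\<close>

lemma less_3_distinct:
  assumes "i < 3" "j < 3" "k < (3 :: nat)" "distinct [i, j, k]"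
  shows "(\<forall>x<3. P x) \<longleftrightarrow> P i \<and> P j \<and> P k"
  using assms unfolding less_3_cases by (auto simp: less_3_iff)

lemma transposition_reflection_permutes:
  "transposition_reflection s v \<Longrightarrow> s permutes {..<3}"
  unfolding transposition_reflection_def by (auto intro!: permutes_swap_id)

lemma transposition_reflection_involution:
  "transposition_reflection s v \<Longrightarrow> s \<circ> s = id"
  unfolding transposition_reflection_def by auto

lemma transposition_reflection_power:
  "transposition_reflection s v \<Longrightarrow> transposition_reflection s (\<lambda>i. v i ^ e)"
  unfolding transposition_reflection_def by (metis power_mult_distrib power_one)

text \<open>Two different transpositions of three points share exactly one point, here named
  j.\<close>

lemma distinct_transposition_reflections:
  assumes "transposition_reflection s v" "transposition_reflection t w" "s \<noteq> t"
  obtains i j k where "i < 3" "j < 3" "k < 3" "distinct [i, j, k]"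
    "s = Transposition.transpose i j" "t = Transposition.transpose j k"
proof -
  obtain i j k where ijk: "i < 3" "j < 3" "k < 3" "distinct [i, j, k]" "s = Transposition.transpose i j"
    using assms(1) by (auto simp: transposition_reflection_def)
  obtain i' j' where ij': "i' < 3" "j' < 3" "i' \<noteq> j'" "t = Transposition.transpose i' j'"
    using assms(2) by (auto simp: transposition_reflection_def)
  have mem: "i' \<in> {i, j, k}" "j' \<in> {i, j, k}"
    using ij'(1,2) ijk(1-4) by (auto simp: less_3_iff)
  then consider "t = Transposition.transpose j k" | "t = Transposition.transpose i k"
    using ij'(3,4) assms(3) ijk(5) by (auto simp: transpose_commute)
  then show thesis
    using that[of i j k] that[of j i k] ijk by cases (auto simp: transpose_commute)
qed

text \<open>The definition hides the indices behind existential quantifiers and a transposition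
  determines its two points only up to order. The conditions on v are symmetric in them, so they
  hold for any chosen naming.\<close>

lemma transposition_reflection_transpose:
  assumes "transposition_reflection (Transposition.transpose i j) v"
    "i < 3" "j < 3" "k < 3" "distinct [i, j, k]"
  shows "v i * v j = 1" "v k = 1"
proof -
  obtain i' j' k' where *: "i' < 3" "j' < 3" "k' < 3" "distinct [i', j', k']"
    "Transposition.transpose i j = Transposition.transpose i' j'" "v i' * v j' = 1" "v k' = 1"
    using assms(1) unfolding transposition_reflection_def by blast
  have "Transposition.transpose i' j' k = k"
    using assms(5) unfolding *(5)[symmetric] by simp
  then have "k = k'"
    using * assms(4) by (auto simp: less_3_iff Transposition.transpose_def split: if_splits)
  then have "i = i' \<and> j = j' \<or> i = j' \<and> j = i'"
    using * assms(2-5) by (auto simp: less_3_iff)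
  then show "v i * v j = 1" "v k = 1"
    using * \<open>k = k'\<close> by (auto simp: mult.commute)
qed

text \<open>The pairs {i, j} and {j, k} form a path, so the values at i and k are determined from
  the one at j and no compatibility condition arises.\<close>

lemma common_fixed_vector_2:
  assumes "transposition_reflection s v" "transposition_reflection t w" "s \<noteq> t"
  obtains a where "\<forall>i<3. a i \<noteq> (0 :: complex)" "\<forall>i<3. v i * a (s i) = a i" "\<forall>i<3. w i * a (t i) = a i"
proof -
  obtain i j k where ijk: "i < 3" "j < 3" "k < 3" "distinct [i, j, k]"
    and s: "s = Transposition.transpose i j" and t: "t = Transposition.transpose j k"
    using distinct_transposition_reflections[OF assms] .
  have v: "v i * v j = 1" "v k = 1"
    using transposition_reflection_transpose[of i j v k] assms(1) ijk by (auto simp: s)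
  have w: "w j * w k = 1" "w i = 1"
    using transposition_reflection_transpose[of j k w i] assms(2) ijk by (auto simp: t)
  \<comment> \<open>normalized by \<open>a j = 1\<close> at the index that both transpositions move\<close>
  define a where "a x = (if x = i then v i else if x = j then 1 else w k)" for x
  show thesis
  proof (rule that)
    show "\<forall>i<3. a i \<noteq> 0" "\<forall>i<3. v i * a (s i) = a i" "\<forall>i<3. w i * a (t i) = a i"
      unfolding less_3_distinct[OF ijk] s t
      using v w ijk(4) by (auto simp: a_def mult.commute)
  qed
qed

text \<open>If \<open>s1 \<noteq> s2\<close>, the product of the first two matrices is a 3-cycle
  matrix fixing a vector a. The product of the last two is its inverse and fixes a vector b. A
  3-cycle matrix has simple eigenvalues, so a and b are proportional. If \<open>s1 = s2\<close>, the
  four matrices cancel in pairs. With four equal permutations a common fixed vector may fail to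
  exist: the matrices then act on a single pair of coordinates, where the relation allows different
  entries.\<close>

lemma common_fixed_vector_4:
  assumes T: "transposition_reflection s1 v1" "transposition_reflection s2 v2"
    "transposition_reflection s3 v3" "transposition_reflection s4 v4"
    and prod: "monomial_mat 3 s1 v1 * monomial_mat 3 s2 v2 * monomial_mat 3 s3 v3 * monomial_mat 3 s4 v4 = 1\<^sub>m 3"
    and ne: "\<not> (s1 = s2 \<and> s2 = s3 \<and> s3 = s4)"
  obtains a where "\<forall>i<3. a i \<noteq> (0 :: complex)" "\<forall>i<3. v1 i * a (s1 i) = a i" "\<forall>i<3. v2 i * a (s2 i) = a i"
    "\<forall>i<3. v3 i * a (s3 i) = a i" "\<forall>i<3. v4 i * a (s4 i) = a i"
proof -
  note P = T[THEN transposition_reflection_permutes]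
  note I = T[THEN transposition_reflection_involution]
  note L = P[THEN permutes_lessThan_less]
  have inv: "s1 (s1 x) = x" "s2 (s2 x) = x" "s3 (s3 x) = x" "s4 (s4 x) = x" for x
    using I by (metis comp_apply id_apply)+
  have P': "s2 \<circ> s1 permutes {..<3}" "s3 \<circ> (s2 \<circ> s1) permutes {..<3}" "s4 \<circ> (s3 \<circ> (s2 \<circ> s1)) permutes {..<3}"
    using P by (simp_all add: permutes_compose)
  have prod': "monomial_mat 3 (s4 \<circ> (s3 \<circ> (s2 \<circ> s1)))
      (\<lambda>x. v1 x * v2 (s1 x) * v3 ((s2 \<circ> s1) x) * v4 ((s3 \<circ> (s2 \<circ> s1)) x)) = monomial_mat 3 id (\<lambda>i. 1)"
    using prod unfolding monomial_mat_mult[OF P(1)] monomial_mat_mult[OF P'(1)] monomial_mat_mult[OF P'(2)]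
      monomial_mat_one .
  have perm: "s4 (s3 (s2 (s1 x))) = x" for x
    using monomial_mat_eqD(1)[OF prod'[symmetric] permutes_id P'(3)] by (simp add: fun_eq_iff)
  have val: "v1 x * v2 (s1 x) * v3 (s2 (s1 x)) * v4 (s3 (s2 (s1 x))) = 1" if "x < 3" for x
    using monomial_mat_eqD(2)[OF prod'[symmetric] permutes_id P'(3) _ that] by simp
  show thesis
  proof (cases "s1 = s2")
    case True
    \<comment> \<open>The first two permutations cancel, so the last two are inverse to each other,
      and involutions that are inverse to each other coincide.\<close>
    have "s4 = s3"
      using perm inv True by (metis ext)
    then have "s1 \<noteq> s3"
      using True ne by simp
    then obtain i j k where ijk: "i < 3" "j < 3" "k < 3" "distinct [i, j, k]"
      and s: "s1 = Transposition.transpose i j" and t: "s3 = Transposition.transpose j k"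
      using distinct_transposition_reflections[OF T(1,3)] by blast
    have "v1 i * v1 j = 1" "v1 k = 1" "v2 i * v2 j = 1" "v2 k = 1"
      using transposition_reflection_transpose[of i j v1 k] transposition_reflection_transpose[of i j v2 k]
        T(1,2) ijk True by (auto simp: s)
    moreover have "v3 j * v3 k = 1" "v3 i = 1" "v4 j * v4 k = 1" "v4 i = 1"
      using transposition_reflection_transpose[of j k v3 i] transposition_reflection_transpose[of j k v4 i]
        T(3,4) ijk \<open>s4 = s3\<close> by (auto simp: t)
    \<comment> \<open>Along the orbit of i the last two matrices contribute 1, along the orbit of k
      the first two do, so the relation splits into one relation for each pair.\<close>
    moreover have "v1 i * v2 j = 1" "v3 k * v4 j = 1"
      using val[of i] val[of k] ijk calculation True[symmetric] by (simp_all add: s t)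
    ultimately have "\<forall>x<3. v2 x = v1 x" "\<forall>x<3. v4 x = v3 x"
      unfolding less_3_distinct[OF ijk] by (metis mult.assoc mult.commute mult.right_neutral)+
    moreover obtain a where "\<forall>i<3. a i \<noteq> 0" "\<forall>i<3. v1 i * a (s1 i) = a i" "\<forall>i<3. v3 i * a (s3 i) = a i"
      using common_fixed_vector_2[OF T(1,3) \<open>s1 \<noteq> s3\<close>] .
    ultimately show ?thesis
      using that[of a] True \<open>s4 = s3\<close> by auto
  next
    case False
    have "s3 \<noteq> s4"
      using perm inv False by (metis ext)
    obtain a where a: "\<forall>i<3. a i \<noteq> 0" "\<forall>i<3. v1 i * a (s1 i) = a i" "\<forall>i<3. v2 i * a (s2 i) = a i"
      using common_fixed_vector_2[OF T(1,2) False] .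
    obtain b where b: "\<forall>i<3. b i \<noteq> 0" "\<forall>i<3. v3 i * b (s3 i) = b i" "\<forall>i<3. v4 i * b (s4 i) = b i"
      using common_fixed_vector_2[OF T(3,4) \<open>s3 \<noteq> s4\<close>] .
    \<comment> \<open>\<open>r\<close> is invariant under the 3-cycle \<open>s2 \<circ> s1\<close>, hence constant\<close>
    define r where "r x = b x / a x" for x
    have r_step: "r (s2 (s1 x)) = r x" if x: "x < 3" for x
    proof -
      define y where "y = s2 (s1 x)"
      have lt: "s1 x < 3" "y < 3" "s3 y < 3" "s4 (s3 y) = x"
        using x L perm by (auto simp: y_def)
      \<comment> \<open>The first two matrices relate the values of a at y and x, the last two
        relate those of b at x and y, and the relation makes the two scalars inverse to each
        other.\<close>
      have "v1 x * v2 (s1 x) * a y = a x" "v3 y * v4 (s3 y) * b x = b y"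
        using a(2,3) b(2,3) lt x by (simp_all add: y_def mult.assoc) (metis lt(4) y_def)
      moreover have "v1 x * v2 (s1 x) * (v3 y * v4 (s3 y)) = 1"
        using val[OF x] by (simp add: y_def mult.assoc)
      ultimately have "a x * b y = b x * a y"
        by (metis mult.assoc mult.commute mult.left_neutral)
      then show ?thesis
        using a(1) lt x unfolding y_def[symmetric] by (simp add: r_def field_simps)
    qed
    obtain i j k where ijk: "i < 3" "j < 3" "k < 3" "distinct [i, j, k]"
      and s: "s1 = Transposition.transpose i j" and t: "s2 = Transposition.transpose j k"
      using distinct_transposition_reflections[OF T(1,2) False] .
    \<comment> \<open>The orbit of the 3-cycle runs through j, i, k, so two of its steps reach every
      point.\<close>
    have "r k = r i" "r i = r j"
      using r_step[of i] r_step[of j] ijk by (simp_all add: s t)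
    then have "\<forall>x<3. r x = r i"
      unfolding less_3_distinct[OF ijk] by simp
    then have ba: "b x = r i * a x" if "x < 3" for x
      using that a(1) by (metis nonzero_divide_eq_eq r_def)
    have "r i \<noteq> 0"
      using a(1) b(1) ijk(1) by (simp add: r_def)
    then have "\<forall>i<3. v3 i * a (s3 i) = a i" "\<forall>i<3. v4 i * a (s4 i) = a i"
      using b(2,3) L by (auto simp: ba)
    then show ?thesis
      using that[of a] a by blast
  qed
qed

section \<open>Triples\<close>

lemma primitive_root_exists:
  assumes "m > 0"
  obtains z where "root_of_unity_of_order m z" "\<And>x. x ^ m = 1 \<Longrightarrow> \<exists>k. x = z ^ k"
proof -
  define z where "z = cis (2 * pi / real m)"
  have zk: "z ^ k = cis (2 * pi * real k / real m)" for k
    unfolding z_def DeMoivre by (simp add: mult.commute)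
  note bij = bij_betw_roots_unity[OF assms]
  show thesis
  proof (rule that)
    have "z ^ k \<noteq> 1" if "0 < k" "k < m" for k
    proof
      assume "z ^ k = 1"
      then have "cis (2 * pi * real k / real m) = cis (2 * pi * real 0 / real m)"
        unfolding zk by simp
      then have "k = 0"
        using bij_betw_imp_inj_on[OF bij] that by (auto dest!: inj_onD[where x = k and y = 0])
      with that show False by simp
    qed
    then show "root_of_unity_of_order m z"
      using assms by (simp add: root_of_unity_of_order_def zk)
    show "\<exists>k. x = z ^ k" if "x ^ m = 1" for x
      using that bij_betw_imp_surj_on[OF bij] zk by force
  qed
qed

lemma root_of_unity_of_order_dvd:
  assumes "root_of_unity_of_order m z" "z ^ k = 1"
  shows "m dvd k"
proof -
  have "z ^ k = (z ^ m) ^ (k div m) * z ^ (k mod m)"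
    by (simp flip: power_mult power_add)
  then have "z ^ (k mod m) = 1"
    using assms by (simp add: root_of_unity_of_order_def)
  moreover have "k mod m < m"
    using assms(1) by (simp add: root_of_unity_of_order_def)
  ultimately have "k mod m = 0"
    using assms(1) by (auto simp: root_of_unity_of_order_def)
  then show ?thesis by auto
qed

lemma monomial_setI:
  "s permutes {..<n} \<Longrightarrow> (\<forall>i<n. v i \<noteq> 0) \<Longrightarrow> Q s v \<Longrightarrow> monomial_mat n s v \<in> monomial_set n Q"
  by (auto simp: monomial_set_def)

text \<open>Membership gives Q only for some function representing the matrix; it agrees with v on
  the indices that the matrix sees.\<close>

lemma monomial_setD:
  assumes "monomial_mat n s v \<in> monomial_set n Q" "s permutes {..<n}" "\<forall>i<n. v i \<noteq> 0"
  obtains w where "Q s w" "\<forall>i<n. w i = v i"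
proof -
  obtain t w where t: "monomial_mat n s v = monomial_mat n t w" "t permutes {..<n}" "Q t w"
    using assms(1) by (auto simp: monomial_set_def)
  have "s = t" "\<forall>i<n. w i = v i"
    using monomial_mat_eqD[OF t(1) assms(2) t(2)] assms(3) by simp_all
  then show thesis
    using that t(3) by simp
qed

lemma G_imprimI:
  assumes "s permutes {..<n}" "m > 0" "\<forall>i<n. v i ^ m = 1" "(\<Prod>i<n. v i) ^ (m div p) = 1"
  shows "monomial_mat n s v \<in> G_imprim m p n"
proof -
  have "\<forall>i<n. v i \<noteq> 0"
    using assms(2,3) by (metis power_eq_0_iff zero_neq_one zero_power)
  then show ?thesis
    unfolding G_imprim_eq_monomial_set using assms by (intro monomial_setI) auto
qed

lemma G_imprimE:
  assumes "A \<in> G_imprim m p n"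
  obtains s v where "A = monomial_mat n s v" "s permutes {..<n}" "\<forall>i<n. v i \<noteq> 0" "\<forall>i<n. v i ^ m = 1"
    "(\<Prod>i<n. v i) ^ (m div p) = 1"
  using assms unfolding G_imprim_eq_monomial_set monomial_set_def by blast

text \<open>The test element diag(z, z^-1, 1) has product of entries 1, so it lies in the group for
  every p, and the bound involves m rather than m/p.\<close>

lemma G_imprim_fixed_vector_order:
  assumes G: "G_imprim m p 3 \<subseteq> monomial_set 3 (\<lambda>s v. \<forall>i<3. v i ^ e * a (s i) = a i)"
    and "a 0 \<noteq> 0" "m > 0" "e > 0"
  shows "m \<le> e"
proof -
  obtain z where z: "root_of_unity_of_order m z"
    using primitive_root_exists[OF assms(3)] .
  have "z ^ m = 1" "z \<noteq> 0"
    using z assms(3) by (auto simp: root_of_unity_of_order_def power_0_left)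
  define v where "v = (\<lambda>i :: nat. if i = 0 then z else if i = 1 then inverse z else 1)"
  have nz: "\<forall>i<3. v i \<noteq> 0"
    using \<open>z \<noteq> 0\<close> by (simp add: v_def)
  have mem: "monomial_mat 3 id v \<in> G_imprim m p 3"
    using \<open>z ^ m = 1\<close> \<open>z \<noteq> 0\<close> assms(3)
    by (intro G_imprimI permutes_id) (simp_all add: less_3_cases prod_lessThan_3 v_def power_inverse)
  obtain w where "\<forall>i<3. w i ^ e * a (id i) = a i" "\<forall>i<3. w i = v i"
    using monomial_setD[OF subsetD[OF G mem] permutes_id nz] .
  then have "z ^ e * a 0 = a 0"
    by (simp add: less_3_cases v_def)
  then have "z ^ e = 1"
    using assms(2) by simp
  then show "m \<le> e"
    using z assms(4) by (meson linorder_not_le root_of_unity_of_order_def)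
qed

text \<open>The test element is diag(z, 1, 1) with z of order m/p: products of entries of group
  elements realize every (m/p)-th root of unity.\<close>

lemma G_imprim_det_order:
  assumes G: "G_imprim m p 3 \<subseteq> monomial_set 3 (\<lambda>s v. (\<Prod>i<3. v i) ^ f = 1)"
    and "m > 0" "p dvd m" "f > 0"
  shows "m div p \<le> f"
proof -
  have q: "m div p > 0" "m = p * (m div p)"
    using assms(2,3) by (auto simp: dvd_div_eq_0_iff)
  obtain z where z: "root_of_unity_of_order (m div p) z"
    using primitive_root_exists[OF q(1)] .
  have zq: "z ^ (m div p) = 1" "z \<noteq> 0"
    using z q by (auto simp: root_of_unity_of_order_def power_0_left)
  have "z ^ m = (z ^ (m div p)) ^ p"
    using q(2) by (metis mult.commute power_mult)
  then have "z ^ m = 1"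
    using zq by simp
  define v where "v = (\<lambda>i :: nat. if i = 0 then z else 1)"
  have nz: "\<forall>i<3. v i \<noteq> 0"
    using zq by (simp add: v_def)
  have mem: "monomial_mat 3 id v \<in> G_imprim m p 3"
    using \<open>z ^ m = 1\<close> zq assms(2)
    by (intro G_imprimI permutes_id) (simp_all add: less_3_cases prod_lessThan_3 v_def)
  obtain w where "(\<Prod>i<3. w i) ^ f = 1" "\<forall>i<3. w i = v i"
    using monomial_setD[OF subsetD[OF G mem] permutes_id nz] .
  then have "z ^ f = 1"
    by (simp add: less_3_cases prod_lessThan_3 v_def)
  then show "m div p \<le> f"
    using z assms(4) by (meson linorder_not_le root_of_unity_of_order_def)
qed

lemma G_imprim_not_stabilizer:
  assumes "m > 0" "c < 3"
  shows "\<not> G_imprim m p 3 \<subseteq> monomial_set 3 (\<lambda>s v. s c = c)"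
proof
  assume G: "G_imprim m p 3 \<subseteq> monomial_set 3 (\<lambda>s v. s c = c)"
  obtain d where d: "d < 3" "d \<noteq> c"
    using that[of 0] that[of 1] by auto
  have perm: "Transposition.transpose c d permutes {..<3}"
    using assms d by (intro permutes_swap_id) auto
  have mem: "monomial_mat 3 (Transposition.transpose c d) (\<lambda>i. 1) \<in> G_imprim m p 3"
    using assms(1) by (intro G_imprimI perm) simp_all
  have "Transposition.transpose c d c = c"
    by (rule monomial_setD[OF subsetD[OF G mem] perm]) auto
  with d show False by simp
qed

section \<open>Reflections of G(m,p,3) and generating triples\<close>

definition reflection_data :: "nat \<Rightarrow> nat \<Rightarrow> complex mat \<Rightarrow> (nat \<Rightarrow> nat) \<Rightarrow> (nat \<Rightarrow> complex) \<Rightarrow> bool" where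
  "reflection_data m q A s v \<longleftrightarrow> A = monomial_mat 3 s v \<and> s permutes {..<3} \<and> (\<forall>i<3. v i \<noteq> 0) \<and>
    (\<forall>i<3. v i ^ m = 1) \<and> (\<Prod>i<3. v i) ^ q = 1 \<and> (diagonal_reflection s v \<or> transposition_reflection s v)"

lemma reflection_data_exists:
  assumes "A \<in> G_imprim m p 3" "is_reflection 3 A"
  obtains s v where "reflection_data m (m div p) A s v"
  using assms(1)
proof (rule G_imprimE)
  fix s v
  assume *: "A = monomial_mat 3 s v" "s permutes {..<3}" "\<forall>i<3. v i \<noteq> 0" "\<forall>i<3. v i ^ m = 1"
    "(\<Prod>i<3. v i) ^ (m div p) = 1"
  then show thesis
    using that[of s v] monomial_reflection_cases[of s v] assms(2) by (simp add: reflection_data_def)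
qed

lemma generate_GL_subset:
  assumes "W = generate (GL n) S" "subgroup H (GL n)" "S \<subseteq> H"
  shows "W \<subseteq> H"
  using assms group.generate_subgroup_incl[OF group_GL] by blast

lemma transposition_reflection_prod:
  assumes "transposition_reflection s v"
  shows "(\<Prod>i<3. v i) = 1"
proof -
  obtain i j k where "i < 3" "j < 3" "k < 3" "distinct [i, j, k]" "v i * v j = 1" "v k = 1"
    using assms by (auto simp: transposition_reflection_def)
  then show ?thesis
    unfolding prod_lessThan_3 less_3_iff by (elim disjE) (auto simp: mult_ac)
qed

lemma diagonal_reflection_prod:
  assumes "diagonal_reflection s v"
  obtains k where "k < 3" "v k \<noteq> 1" "(\<Prod>i<3. v i) = v k" "\<forall>i<3. i \<noteq> k \<longrightarrow> v i = 1"
proof -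
  obtain k where k: "k < 3" "v k \<noteq> 1" "\<forall>i<3. i \<noteq> k \<longrightarrow> v i = 1"
    using assms by (auto simp: diagonal_reflection_def)
  moreover have "(\<Prod>i<3. v i) = v k"
    using k(1,3) unfolding prod_lessThan_3 less_3_iff less_3_cases by (elim disjE) simp_all
  ultimately show thesis
    using that by blast
qed

lemma diagonal_reflection_power:
  assumes "diagonal_reflection s v" "(\<Prod>i<3. v i) ^ e = 1"
  shows "\<forall>i<3. v i ^ e = 1"
  using assms(1)
proof (rule diagonal_reflection_prod)
  fix k assume "k < 3" "(\<Prod>i<3. v i) = v k" "\<forall>i<3. i \<noteq> k \<longrightarrow> v i = 1"
  then show ?thesis
    using assms(2) by (metis power_one)
qed

lemma diagonal_reflection_id: "diagonal_reflection s v \<Longrightarrow> s = id"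
  by (simp add: diagonal_reflection_def)

lemma transposition_reflection_fixes:
  assumes "transposition_reflection s v"
  obtains c where "c < 3" "s c = c"
  using assms unfolding transposition_reflection_def by auto

text \<open>A diagonal reflection fixes every coordinate position, so the other two must be
  different transpositions for the group to move every position. With exponent m/p the diagonal
  matrix becomes the identity, and a vector fixed by two transposition matrices always exists. This
  gives m \<le> m/p.\<close>

lemma three_reflections_generate:
  assumes W: "G_imprim m p 3 = generate (GL 3) {A, B, C}" and m: "m > 0" "p dvd m"
    and A: "reflection_data m (m div p) A s v" "diagonal_reflection s v"
    and B: "reflection_data m (m div p) B t w" and C: "reflection_data m (m div p) C r u"
  shows "p = 1"
proof -
  have "s = id"
    using A(2) by (simp add: diagonal_reflection_def)
  have no_fix: "t c \<noteq> c \<or> r c \<noteq> c" if "c < 3" for c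
  proof (rule ccontr)
    assume "\<not> (t c \<noteq> c \<or> r c \<noteq> c)"
    then have "{A, B, C} \<subseteq> monomial_set 3 (\<lambda>s v. s c = c)"
      using A(1) B C \<open>s = id\<close> by (auto simp: reflection_data_def intro!: monomial_setI)
    then show False
      using generate_GL_subset[OF W subgroup_monomial_stabilizer] G_imprim_not_stabilizer[OF m(1) that] by blast
  qed
  have "\<not> diagonal_reflection t w"
  proof
    assume t: "diagonal_reflection t w"
    show False
    proof (cases "diagonal_reflection r u")
      case True
      with t no_fix[of 0] show False by (simp add: diagonal_reflection_def)
    next
      case False
      then have "transposition_reflection r u"
        using C by (simp add: reflection_data_def)
      then obtain c where "c < 3" "r c = c"
        using transposition_reflection_fixes by blast
      with t no_fix[of c] show False by (simp add: diagonal_reflection_def)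
    qed
  qed
  then have tw: "transposition_reflection t w"
    using B by (simp add: reflection_data_def)
  obtain c where c: "c < 3" "t c = c"
    using transposition_reflection_fixes[OF tw] .
  \<comment> \<open>The third permutation has to move the point that t fixes, so it is neither the
    identity nor t.\<close>
  then have "\<not> diagonal_reflection r u" "t \<noteq> r"
    using no_fix[of c] by (auto simp: diagonal_reflection_def)
  then have ru: "transposition_reflection r u"
    using C by (simp add: reflection_data_def)
  let ?q = "m div p"
  obtain a where a: "\<forall>i<3. a i \<noteq> 0" "\<forall>i<3. w i ^ ?q * a (t i) = a i" "\<forall>i<3. u i ^ ?q * a (r i) = a i"
    using common_fixed_vector_2[OF transposition_reflection_power[OF tw, of ?q]
        transposition_reflection_power[OF ru, of ?q] \<open>t \<noteq> r\<close>] .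
  have "\<forall>i<3. v i ^ ?q * a (s i) = a i"
    using diagonal_reflection_power[OF A(2), of ?q] A(1) \<open>s = id\<close> by (simp add: reflection_data_def)
  then have "{A, B, C} \<subseteq> monomial_set 3 (\<lambda>s v. \<forall>i<3. v i ^ ?q * a (s i) = a i)"
    using A(1) B C a by (auto simp: reflection_data_def intro!: monomial_setI)
  then have sub: "G_imprim m p 3 \<subseteq> monomial_set 3 (\<lambda>s v. \<forall>i<3. v i ^ ?q * a (s i) = a i)"
    using generate_GL_subset[OF W subgroup_monomial_fixed_vector] by blast
  have "p > 0"
    using m by (auto intro: Nat.gr0I)
  then have "?q > 0"
    using m by (auto simp: dvd_div_eq_0_iff)
  then have "m \<le> ?q"
    using G_imprim_fixed_vector_order[OF sub _ m(1)] a(1) by simp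
  then show "p = 1"
    using m \<open>p > 0\<close> by (metis One_nat_def Suc_lessI div_less_dividend linorder_not_le)
qed

lemma no_nice_triple:
  assumes "nice_tuple 3 3 (G_imprim m p 3) As" "m > 0" "p dvd m"
  shows "p = 1 \<or> p = m"
proof -
  obtain A B C where As: "As = [A, B, C]"
    using assms(1) by (auto simp: nice_tuple_def numeral_3_eq_3 length_Suc_conv)
  have W: "G_imprim m p 3 = generate (GL 3) {A, B, C}"
    using assms(1) by (simp add: nice_tuple_def As)
  have mem: "A \<in> G_imprim m p 3" "B \<in> G_imprim m p 3" "C \<in> G_imprim m p 3"
    and refl: "is_reflection 3 A" "is_reflection 3 B" "is_reflection 3 C"
    using assms(1) by (auto simp: nice_tuple_def As)
  obtain s v where A: "reflection_data m (m div p) A s v"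
    using reflection_data_exists[OF mem(1) refl(1)] .
  obtain t w where B: "reflection_data m (m div p) B t w"
    using reflection_data_exists[OF mem(2) refl(2)] .
  obtain r u where C: "reflection_data m (m div p) C r u"
    using reflection_data_exists[OF mem(3) refl(3)] .
  consider "diagonal_reflection s v" | "diagonal_reflection t w" | "diagonal_reflection r u"
    | "transposition_reflection s v" "transposition_reflection t w" "transposition_reflection r u"
    using A B C by (auto simp: reflection_data_def)
  then show ?thesis
  proof cases
    case 1
    then show ?thesis
      using three_reflections_generate[OF W assms(2,3) A _ B C] by simp
  next
    case 2
    then show ?thesis
      using three_reflections_generate[OF _ assms(2,3) B _ A C] W by (simp add: insert_commute)
  next
    case 3
    then show ?thesis
      using three_reflections_generate[OF _ assms(2,3) C _ A B] W by (simp add: insert_commute)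
  next
    case 4
    \<comment> \<open>Transposition reflections have product of entries 1, so three of them generate
      only elements of product 1, which forces m/p = 1.\<close>
    then have "{A, B, C} \<subseteq> monomial_set 3 (\<lambda>s v. (\<Prod>i<3. v i) ^ 1 = 1)"
      using A B C by (auto simp: reflection_data_def transposition_reflection_prod intro!: monomial_setI)
    then have sub: "G_imprim m p 3 \<subseteq> monomial_set 3 (\<lambda>s v. (\<Prod>i<3. v i) ^ 1 = 1)"
      by (rule generate_GL_subset[OF W subgroup_monomial_det])
    have "m div p \<le> 1"
      by (rule G_imprim_det_order[OF sub assms(2,3)]) simp
    moreover have "m = p * (m div p)"
      using assms(3) by simp
    ultimately show ?thesis
      using assms(2) by (metis le_neq_implies_less less_one mult.right_neutral mult_0_right not_gr_zero)
  qed
qed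

section \<open>Quadruples\<close>

text \<open>A tuple followed by the inverse of its product is a relation of length five. It is read
  off in the permutations, in their signs, in the products of entries and after taking e-th powers
  of entries.\<close>

lemma monomial_mat_mult_5_eq_one:
  assumes P: "s1 permutes {..<n}" "s2 permutes {..<n}" "s3 permutes {..<n}" "s4 permutes {..<n}" "t permutes {..<n}"
    and prod: "monomial_mat n s1 v1 * monomial_mat n s2 v2 * monomial_mat n s3 v3 * monomial_mat n s4 v4 *
      monomial_mat n t u = 1\<^sub>m n"
  shows "t (s4 (s3 (s2 (s1 x)))) = x"
    and "sign s1 * sign s2 * sign s3 * sign s4 * sign t = 1"
    and "(\<Prod>i<n. v1 i) * (\<Prod>i<n. v2 i) * (\<Prod>i<n. v3 i) * (\<Prod>i<n. v4 i) * (\<Prod>i<n. u i) = 1"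
    and "monomial_mat n s1 (\<lambda>i. v1 i ^ e) * monomial_mat n s2 (\<lambda>i. v2 i ^ e) * monomial_mat n s3 (\<lambda>i. v3 i ^ e) *
      monomial_mat n s4 (\<lambda>i. v4 i ^ e) * monomial_mat n t (\<lambda>i. u i ^ e) = 1\<^sub>m n"
proof -
  have P': "s2 \<circ> s1 permutes {..<n}" "s3 \<circ> (s2 \<circ> s1) permutes {..<n}" "s4 \<circ> (s3 \<circ> (s2 \<circ> s1)) permutes {..<n}"
    "t \<circ> (s4 \<circ> (s3 \<circ> (s2 \<circ> s1))) permutes {..<n}"
    using P by (simp_all add: permutes_compose)
  note mult = monomial_mat_mult[OF P(1)] monomial_mat_mult[OF P'(1)] monomial_mat_mult[OF P'(2)]
    monomial_mat_mult[OF P'(3)]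
  have eq: "1\<^sub>m n = monomial_mat n (t \<circ> (s4 \<circ> (s3 \<circ> (s2 \<circ> s1))))
      (\<lambda>x. v1 x * v2 (s1 x) * v3 ((s2 \<circ> s1) x) * v4 ((s3 \<circ> (s2 \<circ> s1)) x) * u ((s4 \<circ> (s3 \<circ> (s2 \<circ> s1))) x))"
    using prod unfolding mult by simp
  have perm: "t \<circ> (s4 \<circ> (s3 \<circ> (s2 \<circ> s1))) = id"
    using monomial_mat_eqD(1)[OF eq[unfolded monomial_mat_one] permutes_id P'(4)] by simp
  then show "t (s4 (s3 (s2 (s1 x)))) = x"
    by (simp add: fun_eq_iff)
  have val: "v1 x * v2 (s1 x) * v3 ((s2 \<circ> s1) x) * v4 ((s3 \<circ> (s2 \<circ> s1)) x) * u ((s4 \<circ> (s3 \<circ> (s2 \<circ> s1))) x) = 1"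
    if "x < n" for x
    using monomial_mat_eqD(2)[OF eq[unfolded monomial_mat_one] permutes_id P'(4) _ that] by simp
  have permutation: "permutation p" if "p permutes {..<n}" for p
    using that permutation_permutes by blast
  have "sign (t \<circ> (s4 \<circ> (s3 \<circ> (s2 \<circ> s1)))) = sign t * (sign s4 * (sign s3 * (sign s2 * sign s1)))"
    using P P' by (simp add: sign_compose permutation)
  then show "sign s1 * sign s2 * sign s3 * sign s4 * sign t = 1"
    unfolding perm by (simp add: mult_ac)
  have "(\<Prod>x<n. v1 x * v2 (s1 x) * v3 ((s2 \<circ> s1) x) * v4 ((s3 \<circ> (s2 \<circ> s1)) x) *
      u ((s4 \<circ> (s3 \<circ> (s2 \<circ> s1))) x)) = 1"
    using val by simp
  then show "(\<Prod>i<n. v1 i) * (\<Prod>i<n. v2 i) * (\<Prod>i<n. v3 i) * (\<Prod>i<n. v4 i) * (\<Prod>i<n. u i) = 1"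
    unfolding prod.distrib prod_permutes_lessThan[OF P(1)] prod_permutes_lessThan[OF P'(1)]
      prod_permutes_lessThan[OF P'(2)] prod_permutes_lessThan[OF P'(3)] .
  show "monomial_mat n s1 (\<lambda>i. v1 i ^ e) * monomial_mat n s2 (\<lambda>i. v2 i ^ e) * monomial_mat n s3 (\<lambda>i. v3 i ^ e) *
      monomial_mat n s4 (\<lambda>i. v4 i ^ e) * monomial_mat n t (\<lambda>i. u i ^ e) = 1\<^sub>m n"
    unfolding mult monomial_mat_one perm
    using val by (intro monomial_mat_cong) (simp_all flip: power_mult_distrib)
qed

lemma sign_transposition_reflection: "transposition_reflection s v \<Longrightarrow> sign s = - 1"
  by (auto simp: transposition_reflection_def sign_swap_id)

lemma sign_diagonal_reflection: "diagonal_reflection s v \<Longrightarrow> sign s = 1"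
  by (simp add: diagonal_reflection_def)

text \<open>
  Exactly two transpositions cannot occur: they would be equal because their product is trivial, and
  the point that they fix would be fixed by all four permutations.
\<close>

lemma four_reflections_types:
  assumes R: "diagonal_reflection s1 v1 \<or> transposition_reflection s1 v1"
      "diagonal_reflection s2 v2 \<or> transposition_reflection s2 v2"
      "diagonal_reflection s3 v3 \<or> transposition_reflection s3 v3"
      "diagonal_reflection s4 v4 \<or> transposition_reflection s4 v4"
    and perm: "\<And>x. t (s4 (s3 (s2 (s1 x)))) = x"
    and sign: "sign s1 * sign s2 * sign s3 * sign s4 * sign t = 1"
    and t: "t = id \<or> sign t = - 1"
    and no_fix: "\<And>c. c < 3 \<Longrightarrow> \<not> (s1 c = c \<and> s2 c = c \<and> s3 c = c \<and> s4 c = c)"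
  shows "t = id \<and> transposition_reflection s1 v1 \<and> transposition_reflection s2 v2 \<and>
      transposition_reflection s3 v3 \<and> transposition_reflection s4 v4 \<or>
    sign t = - 1 \<and>
     (diagonal_reflection s1 v1 \<and> transposition_reflection s2 v2 \<and> transposition_reflection s3 v3 \<and> transposition_reflection s4 v4 \<or>
      transposition_reflection s1 v1 \<and> diagonal_reflection s2 v2 \<and> transposition_reflection s3 v3 \<and> transposition_reflection s4 v4 \<or>
      transposition_reflection s1 v1 \<and> transposition_reflection s2 v2 \<and> diagonal_reflection s3 v3 \<and> transposition_reflection s4 v4 \<or>
      transposition_reflection s1 v1 \<and> transposition_reflection s2 v2 \<and> transposition_reflection s3 v3 \<and> diagonal_reflection s4 v4)"
proof -
  have fixed: "\<exists>c<3. s c = c" if "diagonal_reflection s v \<or> transposition_reflection s v" for s v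
    using that
  proof
    assume "diagonal_reflection s v"
    then show ?thesis
      by (auto simp: diagonal_reflection_def)
  next
    assume "transposition_reflection s v"
    then show ?thesis
      using transposition_reflection_fixes by blast
  qed
  \<comment> \<open>Parity leaves an even number of transpositions for t = id and an odd number for
    an odd t. Three identities are excluded in either case, since the remaining permutation fixes
    some point.\<close>
  have no_fix_3: "\<not> (s1 = id \<and> s2 = id \<and> s3 = id)" "\<not> (s1 = id \<and> s2 = id \<and> s4 = id)"
    "\<not> (s1 = id \<and> s3 = id \<and> s4 = id)" "\<not> (s2 = id \<and> s3 = id \<and> s4 = id)"
    using fixed[OF R(1)] fixed[OF R(2)] fixed[OF R(3)] fixed[OF R(4)] no_fix by auto
  have no_fix_2: "t = id \<Longrightarrow> \<not> (s1 = id \<and> s2 = id)" "t = id \<Longrightarrow> \<not> (s1 = id \<and> s3 = id)"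
    "t = id \<Longrightarrow> \<not> (s1 = id \<and> s4 = id)" "t = id \<Longrightarrow> \<not> (s2 = id \<and> s3 = id)"
    "t = id \<Longrightarrow> \<not> (s2 = id \<and> s4 = id)" "t = id \<Longrightarrow> \<not> (s3 = id \<and> s4 = id)"
    using fixed[OF R(1)] fixed[OF R(2)] fixed[OF R(3)] fixed[OF R(4)] no_fix perm by (metis id_apply)+
  show ?thesis
    using t
  proof
    assume t: "t = id"
    show ?thesis
      using R sign no_fix_2[OF t] t
      by (elim disjE) (simp_all add: sign_transposition_reflection sign_diagonal_reflection diagonal_reflection_id)
  next
    assume t: "sign t = - 1"
    show ?thesis
      using R sign no_fix_3 t
      by (elim disjE) (simp_all add: sign_transposition_reflection sign_diagonal_reflection diagonal_reflection_id)
  qed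
qed

text \<open>Among the five factors of the relation, four are transposition matrices after passing to
  e-th powers and the remaining one becomes the identity. It is the last factor when t = id, and
  otherwise the single diagonal reflection, wherever it stands in the tuple.\<close>

lemma four_reflections_fixed_vector:
  assumes P: "s1 permutes {..<3}" "s2 permutes {..<3}" "s3 permutes {..<3}" "s4 permutes {..<3}" "t permutes {..<3}"
    and R: "diagonal_reflection s1 v1 \<or> transposition_reflection s1 v1"
      "diagonal_reflection s2 v2 \<or> transposition_reflection s2 v2"
      "diagonal_reflection s3 v3 \<or> transposition_reflection s3 v3"
      "diagonal_reflection s4 v4 \<or> transposition_reflection s4 v4"
    and prod: "monomial_mat 3 s1 v1 * monomial_mat 3 s2 v2 * monomial_mat 3 s3 v3 * monomial_mat 3 s4 v4 *
      monomial_mat 3 t u = 1\<^sub>m 3"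
    and no_fix: "\<And>c. c < 3 \<Longrightarrow> \<not> (s1 c = c \<and> s2 c = c \<and> s3 c = c \<and> s4 c = c)"
    and t: "t = id \<and> (\<forall>i<3. u i ^ e = 1) \<or> transposition_reflection t (\<lambda>i. u i ^ e)"
  obtains a where "\<forall>i<3. a i \<noteq> (0 :: complex)" "\<forall>i<3. v1 i ^ e * a (s1 i) = a i" "\<forall>i<3. v2 i ^ e * a (s2 i) = a i"
    "\<forall>i<3. v3 i ^ e * a (s3 i) = a i" "\<forall>i<3. v4 i ^ e * a (s4 i) = a i"
proof -
  note facts = monomial_mat_mult_5_eq_one[OF P prod]
  note powers = facts(4)[of e]
  have t': "t = id \<or> sign t = - 1"
    using t sign_transposition_reflection by blast
  note types = four_reflections_types[OF R facts(1,2) t' no_fix]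
  have one: "monomial_mat 3 id w = 1\<^sub>m 3" if "\<forall>i<3. w i = 1" for w
    unfolding monomial_mat_one using that by (intro monomial_mat_cong) auto
  have one_mult: "A * 1\<^sub>m 3 = A" "1\<^sub>m 3 * A = A" if "A \<in> carrier_mat 3 3" for A :: "complex mat"
    using that by simp_all
  have u_prod: "(\<Prod>i<3. u i) ^ e = 1"
  proof (cases "t = id \<and> (\<forall>i<3. u i ^ e = 1)")
    case True
    then show ?thesis
      by (simp add: prod_power_distrib)
  next
    case False
    then have "(\<Prod>i<3. u i ^ e) = 1"
      using t transposition_reflection_prod by blast
    then show ?thesis
      by (simp add: prod_power_distrib)
  qed
  \<comment> \<open>Transposition reflections contribute 1 to this product, so in the mixed cases it
    is the nontrivial entry of the diagonal reflection, whose e-th power is therefore 1.\<close>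
  have det: "((\<Prod>i<3. v1 i) * (\<Prod>i<3. v2 i) * (\<Prod>i<3. v3 i) * (\<Prod>i<3. v4 i)) ^ e = 1"
    using facts(3) u_prod by (metis mult.right_neutral power_mult_distrib power_one)
  have diag: "\<forall>i<3. w i ^ e = 1" if "diagonal_reflection s w" "(\<Prod>i<3. w i) ^ e = 1" for s w
    using diagonal_reflection_power[OF that] .
  consider (0) "t = id" "transposition_reflection s1 v1" "transposition_reflection s2 v2"
      "transposition_reflection s3 v3" "transposition_reflection s4 v4"
    | (1) "sign t = - 1" "diagonal_reflection s1 v1" "transposition_reflection s2 v2" "transposition_reflection s3 v3" "transposition_reflection s4 v4"
    | (2) "sign t = - 1" "transposition_reflection s1 v1" "diagonal_reflection s2 v2" "transposition_reflection s3 v3" "transposition_reflection s4 v4"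
    | (3) "sign t = - 1" "transposition_reflection s1 v1" "transposition_reflection s2 v2" "diagonal_reflection s3 v3" "transposition_reflection s4 v4"
    | (4) "sign t = - 1" "transposition_reflection s1 v1" "transposition_reflection s2 v2" "transposition_reflection s3 v3" "diagonal_reflection s4 v4"
    using types by blast
  then show thesis
  proof cases
    case 0
    have u: "\<forall>i<3. u i ^ e = 1"
      using t 0(1) sign_transposition_reflection by (metis one_neq_neg_one sign_id)
    obtain c where "c < 3" "s1 c = c"
      using transposition_reflection_fixes[OF 0(2)] .
    \<comment> \<open>If all four permutations agreed, their common fixed point would be fixed by
      the whole group.\<close>
    then have ne: "\<not> (s1 = s2 \<and> s2 = s3 \<and> s3 = s4)"
      using no_fix by metis
    have "monomial_mat 3 s1 (\<lambda>i. v1 i ^ e) * monomial_mat 3 s2 (\<lambda>i. v2 i ^ e) * monomial_mat 3 s3 (\<lambda>i. v3 i ^ e) *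
        monomial_mat 3 s4 (\<lambda>i. v4 i ^ e) = 1\<^sub>m 3"
      using powers unfolding 0(1) one[OF u] by (simp add: one_mult mult_carrier_mat[of _ 3 3])
    from common_fixed_vector_4[OF 0(2-5)[THEN transposition_reflection_power, of e] this ne] that
    show ?thesis by blast
  next
    case 1
    have T: "transposition_reflection t (\<lambda>i. u i ^ e)"
      using t 1(1) by auto
    have w: "\<forall>i<3. v1 i ^ e = 1" and s: "s1 = id"
      using diag[OF 1(2)] det diagonal_reflection_id[OF 1(2)] 1(3-5) by (simp_all add: transposition_reflection_prod)
    obtain c where "c < 3" "s2 c = c"
      using transposition_reflection_fixes[OF 1(3)] .
    \<comment> \<open>Here the diagonal reflection fixes c as well, so equality of the remaining
      permutations would again give a point fixed by all four. The other mixed cases repeat this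
      with the diagonal factor in another place.\<close>
    then have ne: "\<not> (s2 = s3 \<and> s3 = s4 \<and> s4 = t)"
      using no_fix s by (metis id_apply)
    have prod4: "monomial_mat 3 s2 (\<lambda>i. v2 i ^ e) * monomial_mat 3 s3 (\<lambda>i. v3 i ^ e) *
        monomial_mat 3 s4 (\<lambda>i. v4 i ^ e) * monomial_mat 3 t (\<lambda>i. u i ^ e) = 1\<^sub>m 3"
      using powers unfolding s one[OF w] by (simp add: one_mult mult_carrier_mat[of _ 3 3])
    obtain a where "\<forall>i<3. a i \<noteq> 0" "\<forall>i<3. v2 i ^ e * a (s2 i) = a i" "\<forall>i<3. v3 i ^ e * a (s3 i) = a i" "\<forall>i<3. v4 i ^ e * a (s4 i) = a i"
      using common_fixed_vector_4[OF 1(3-5)[THEN transposition_reflection_power, of e] T prod4 ne] .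
    with that[of a] s w show ?thesis by simp
  next
    case 2
    have T: "transposition_reflection t (\<lambda>i. u i ^ e)"
      using t 2(1) by auto
    have w: "\<forall>i<3. v2 i ^ e = 1" and s: "s2 = id"
      using diag[OF 2(3)] det diagonal_reflection_id[OF 2(3)] 2(2,4-5) by (simp_all add: transposition_reflection_prod)
    obtain c where "c < 3" "s1 c = c"
      using transposition_reflection_fixes[OF 2(2)] .
    then have ne: "\<not> (s1 = s3 \<and> s3 = s4 \<and> s4 = t)"
      using no_fix s by (metis id_apply)
    have prod4: "monomial_mat 3 s1 (\<lambda>i. v1 i ^ e) * monomial_mat 3 s3 (\<lambda>i. v3 i ^ e) *
        monomial_mat 3 s4 (\<lambda>i. v4 i ^ e) * monomial_mat 3 t (\<lambda>i. u i ^ e) = 1\<^sub>m 3"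
      using powers unfolding s one[OF w] by (simp add: one_mult mult_carrier_mat[of _ 3 3])
    obtain a where "\<forall>i<3. a i \<noteq> 0" "\<forall>i<3. v1 i ^ e * a (s1 i) = a i" "\<forall>i<3. v3 i ^ e * a (s3 i) = a i" "\<forall>i<3. v4 i ^ e * a (s4 i) = a i"
      using common_fixed_vector_4[OF 2(2,4,5)[THEN transposition_reflection_power, of e] T prod4 ne] .
    with that[of a] s w show ?thesis by simp
  next
    case 3
    have T: "transposition_reflection t (\<lambda>i. u i ^ e)"
      using t 3(1) by auto
    have w: "\<forall>i<3. v3 i ^ e = 1" and s: "s3 = id"
      using diag[OF 3(4)] det diagonal_reflection_id[OF 3(4)] 3(2,3,5) by (simp_all add: transposition_reflection_prod)
    obtain c where "c < 3" "s1 c = c"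
      using transposition_reflection_fixes[OF 3(2)] .
    then have ne: "\<not> (s1 = s2 \<and> s2 = s4 \<and> s4 = t)"
      using no_fix s by (metis id_apply)
    have prod4: "monomial_mat 3 s1 (\<lambda>i. v1 i ^ e) * monomial_mat 3 s2 (\<lambda>i. v2 i ^ e) *
        monomial_mat 3 s4 (\<lambda>i. v4 i ^ e) * monomial_mat 3 t (\<lambda>i. u i ^ e) = 1\<^sub>m 3"
      using powers unfolding s one[OF w] by (simp add: one_mult mult_carrier_mat[of _ 3 3])
    obtain a where "\<forall>i<3. a i \<noteq> 0" "\<forall>i<3. v1 i ^ e * a (s1 i) = a i" "\<forall>i<3. v2 i ^ e * a (s2 i) = a i" "\<forall>i<3. v4 i ^ e * a (s4 i) = a i"
      using common_fixed_vector_4[OF 3(2,3,5)[THEN transposition_reflection_power, of e] T prod4 ne] .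
    with that[of a] s w show ?thesis by simp
  next
    case 4
    have T: "transposition_reflection t (\<lambda>i. u i ^ e)"
      using t 4(1) by auto
    have w: "\<forall>i<3. v4 i ^ e = 1" and s: "s4 = id"
      using diag[OF 4(5)] det diagonal_reflection_id[OF 4(5)] 4(2-4) by (simp_all add: transposition_reflection_prod)
    obtain c where "c < 3" "s1 c = c"
      using transposition_reflection_fixes[OF 4(2)] .
    then have ne: "\<not> (s1 = s2 \<and> s2 = s3 \<and> s3 = t)"
      using no_fix s by (metis id_apply)
    have prod4: "monomial_mat 3 s1 (\<lambda>i. v1 i ^ e) * monomial_mat 3 s2 (\<lambda>i. v2 i ^ e) *
        monomial_mat 3 s3 (\<lambda>i. v3 i ^ e) * monomial_mat 3 t (\<lambda>i. u i ^ e) = 1\<^sub>m 3"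
      using powers unfolding s one[OF w] by (simp add: one_mult mult_carrier_mat[of _ 3 3])
    obtain a where "\<forall>i<3. a i \<noteq> 0" "\<forall>i<3. v1 i ^ e * a (s1 i) = a i" "\<forall>i<3. v2 i ^ e * a (s2 i) = a i" "\<forall>i<3. v3 i ^ e * a (s3 i) = a i"
      using common_fixed_vector_4[OF 4(2-4)[THEN transposition_reflection_power, of e] T prod4 ne] .
    with that[of a] s w show ?thesis by simp
  qed
qed

lemma prod_lessThan_3_distinct:
  assumes "i < 3" "j < 3" "k < (3 :: nat)" "distinct [i, j, k]"
  shows "(\<Prod>x<3. f x) = f i * f j * (f k :: complex)"
  using assms unfolding prod_lessThan_3 less_3_iff by (elim disjE) (simp_all add: mult_ac)

text \<open>The order of l and the restriction on p are proved together because the second rests on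
  the first: comparison of products of entries yields divisibility by m only once l is known to have
  order exactly m.\<close>

lemma nice_quadruple:
  assumes nice: "nice_tuple 3 4 (G_imprim m p 3) As" and mc: "mc_parameter 3 As l"
    and m: "m > 0" "p dvd m"
  shows "root_of_unity_of_order m l \<and>
    (p = m \<and> m \<noteq> 3 \<or> p = 1 \<and> coprime m 3 \<or> p = 3 \<and> (\<exists>k>1. m = 3 * k))"
proof -
  interpret group "GL 3"
    by (rule group_GL)
  interpret G: subgroup "G_imprim m p 3" "GL 3"
    by (rule subgroup_G_imprim)
  obtain A1 A2 A3 A4 where As: "As = [A1, A2, A3, A4]"
    using nice by (auto simp: nice_tuple_def numeral_eq_Suc length_Suc_conv)
  have W: "G_imprim m p 3 = generate (GL 3) {A1, A2, A3, A4}"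
    using nice by (simp add: nice_tuple_def As)
  have mem: "A1 \<in> G_imprim m p 3" "A2 \<in> G_imprim m p 3" "A3 \<in> G_imprim m p 3" "A4 \<in> G_imprim m p 3"
    and refl: "is_reflection 3 A1" "is_reflection 3 A2" "is_reflection 3 A3" "is_reflection 3 A4"
    using nice by (auto simp: nice_tuple_def As)
  define q where "q = m div p"
  have pq: "m = p * q" "q > 0" "p > 0"
    using m by (auto simp: q_def dvd_div_eq_0_iff intro: Nat.gr0I)
  obtain s1 v1 where A1: "reflection_data m q A1 s1 v1"
    using reflection_data_exists[OF mem(1) refl(1)] unfolding q_def .
  obtain s2 v2 where A2: "reflection_data m q A2 s2 v2"
    using reflection_data_exists[OF mem(2) refl(2)] unfolding q_def .
  obtain s3 v3 where A3: "reflection_data m q A3 s3 v3"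
    using reflection_data_exists[OF mem(3) refl(3)] unfolding q_def .
  obtain s4 v4 where A4: "reflection_data m q A4 s4 v4"
    using reflection_data_exists[OF mem(4) refl(4)] unfolding q_def .
  have A: "A1 = monomial_mat 3 s1 v1" "A2 = monomial_mat 3 s2 v2" "A3 = monomial_mat 3 s3 v3" "A4 = monomial_mat 3 s4 v4"
    and perms: "s1 permutes {..<3}" "s2 permutes {..<3}" "s3 permutes {..<3}" "s4 permutes {..<3}"
    and R: "diagonal_reflection s1 v1 \<or> transposition_reflection s1 v1"
      "diagonal_reflection s2 v2 \<or> transposition_reflection s2 v2"
      "diagonal_reflection s3 v3 \<or> transposition_reflection s3 v3"
      "diagonal_reflection s4 v4 \<or> transposition_reflection s4 v4"
    and dets: "(\<Prod>i<3. v1 i) ^ q = 1" "(\<Prod>i<3. v2 i) ^ q = 1" "(\<Prod>i<3. v3 i) ^ q = 1" "(\<Prod>i<3. v4 i) ^ q = 1"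
    and nz: "\<forall>i<3. v1 i \<noteq> 0" "\<forall>i<3. v2 i \<noteq> 0" "\<forall>i<3. v3 i \<noteq> 0" "\<forall>i<3. v4 i \<noteq> 0"
    using A1 A2 A3 A4 by (auto simp: reflection_data_def)
  have W_subset: "G_imprim m p 3 \<subseteq> monomial_set 3 Q"
    if "subgroup (monomial_set 3 Q) (GL 3)" "Q s1 v1" "Q s2 v2" "Q s3 v3" "Q s4 v4" for Q
    using generate_GL_subset[OF W that(1)] that(2-) perms nz by (auto simp: A intro: monomial_setI)
  \<comment> \<open>\<open>mc_parameter\<close> multiplies with \<open>foldr\<close>, so the product
    is nested to the right and ends in the unit.\<close>
  define P where "P = A1 \<otimes>\<^bsub>GL 3\<^esub> (A2 \<otimes>\<^bsub>GL 3\<^esub> (A3 \<otimes>\<^bsub>GL 3\<^esub> (A4 \<otimes>\<^bsub>GL 3\<^esub> \<one>\<^bsub>GL 3\<^esub>)))"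
  have P: "P \<in> G_imprim m p 3"
    unfolding P_def using mem by (intro G.m_closed G.one_closed)
  define B where "B = inv\<^bsub>GL 3\<^esub> P"
  have "B \<in> G_imprim m p 3"
    unfolding B_def using P by (rule G.m_inv_closed)
  then obtain t u where B: "B = monomial_mat 3 t u" and t: "t permutes {..<3}"
    and u: "\<forall>i<3. u i \<noteq> 0" "\<forall>i<3. u i ^ m = 1"
    by (rule G_imprimE)
  have l: "l \<noteq> 1" "multiplicity_eigenvalue (monomial_mat 3 t u) l = 2"
    using mc by (simp_all add: mc_parameter_def As Let_def P_def[symmetric] B_def[symmetric] B)
  have "P \<otimes>\<^bsub>GL 3\<^esub> B = \<one>\<^bsub>GL 3\<^esub>"
    unfolding B_def using P G.subset by (intro r_inv) blast
  moreover have "P = A1 * A2 * A3 * A4"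
    unfolding P_def GL_simps A
    by (simp add: assoc_mult_mat[of _ 3 3 _ 3 _ 3] mult_carrier_mat[of _ 3 3] right_mult_one_mat[OF monomial_mat_carrier])
  ultimately have prod: "monomial_mat 3 s1 v1 * monomial_mat 3 s2 v2 * monomial_mat 3 s3 v3 * monomial_mat 3 s4 v4 *
      monomial_mat 3 t u = 1\<^sub>m 3"
    unfolding GL_simps A B by simp
  note facts = monomial_mat_mult_5_eq_one[OF perms t prod]
  have no_fix: "\<not> (s1 c = c \<and> s2 c = c \<and> s3 c = c \<and> s4 c = c)" if "c < 3" for c
    using W_subset[OF subgroup_monomial_stabilizer] G_imprim_not_stabilizer[OF m(1) that] by blast
  \<comment> \<open>The exponent e stays arbitrary so that this can be applied to every e with
    \<open>l ^ e = 1\<close>.\<close>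
  have min: "m \<le> e" if e: "e > 0" "t = id \<and> (\<forall>i<3. u i ^ e = 1) \<or> transposition_reflection t (\<lambda>i. u i ^ e)" for e
  proof -
    obtain a where a: "\<forall>i<3. a i \<noteq> 0" "\<forall>i<3. v1 i ^ e * a (s1 i) = a i" "\<forall>i<3. v2 i ^ e * a (s2 i) = a i"
        "\<forall>i<3. v3 i ^ e * a (s3 i) = a i" "\<forall>i<3. v4 i ^ e * a (s4 i) = a i"
      using four_reflections_fixed_vector[OF perms t R prod no_fix e(2)] .
    have "a 0 \<noteq> 0"
      using a(1) by simp
    then show ?thesis
      using G_imprim_fixed_vector_order[OF W_subset[OF subgroup_monomial_fixed_vector a(2-5)] _ m(1) e(1)] by blast
  qed
  have l_order: "root_of_unity_of_order m l"
    if "l ^ m = 1" "\<And>e. e > 0 \<Longrightarrow> l ^ e = 1 \<Longrightarrow> m \<le> e"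
    unfolding root_of_unity_of_order_def using that m(1) by (metis leD)
  have det_order: "q \<le> f" if f: "f > 0" "(\<Prod>i<3. v1 i) ^ f = 1" "(\<Prod>i<3. v2 i) ^ f = 1" "(\<Prod>i<3. v3 i) ^ f = 1"
      "(\<Prod>i<3. v4 i) ^ f = 1" for f
    using G_imprim_det_order[OF W_subset[OF subgroup_monomial_det f(2-5)] m f(1)] by (simp add: q_def)
  from l(2) t u(1) show ?thesis
  proof (cases rule: double_eigenvalue_cases)
    case (1 k)
    note types = four_reflections_types[OF R facts(1,2) disjI1[OF 1(1)] no_fix]
    have T: "transposition_reflection s1 v1" "transposition_reflection s2 v2" "transposition_reflection s3 v3"
      "transposition_reflection s4 v4"
      using types 1(1) by auto
    obtain x y where xy: "x < 3" "y < 3" "distinct [x, y, k]"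
      using 1(2) that[of 0 1] that[of 0 2] that[of 1 2] by (auto simp: less_3_iff)
    have uxy: "u x = l" "u y = l"
      using 1(4) xy by auto
    have "(\<Prod>i<3. u i) = 1"
      using facts(3) T by (simp add: transposition_reflection_prod)
    then have uk: "l * l * u k = 1"
      using prod_lessThan_3_distinct[OF xy(1,2) 1(2), of u] xy(3) uxy by simp
    have "m \<le> e" if e: "e > 0" "l ^ e = 1" for e
    proof (rule min[OF e(1)])
      \<comment> \<open>The third diagonal entry is l^-2, so its e-th power is trivial together with
        that of l.\<close>
      have "(l * l * u k) ^ e = 1"
        using uk by simp
      then have "u k ^ e = 1"
        using e(2) by (simp add: power_mult_distrib)
      then show "t = id \<and> (\<forall>i<3. u i ^ e = 1) \<or> transposition_reflection t (\<lambda>i. u i ^ e)"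
        using 1(1,4) e(2) by metis
    qed
    moreover have "l ^ m = 1"
      using u(2) xy(1) uxy(1) by auto
    ultimately have order: "root_of_unity_of_order m l"
      by (intro l_order)
    have "q \<le> 1"
      using T by (intro det_order) (simp_all add: transposition_reflection_prod)
    then have "p = m"
      using pq by simp
    moreover have "m \<noteq> 3"
    proof
      assume "m = 3"
      \<comment> \<open>For m = 3 the entry l^-2 equals l, and the eigenvalue would be
        triple.\<close>
      then have "l * l * l = 1"
        using \<open>l ^ m = 1\<close> by (simp add: power3_eq_cube)
      then have "u k = l"
        using uk by (metis mult_cancel_left mult_zero_left zero_neq_one)
      with 1(3) show False by simp
    qed
    ultimately show ?thesis
      using order by simp
  next
    case (2 i j k)
    have sign_t: "sign t = - 1"
      using 2(4,5) by (simp add: sign_swap_id)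
    note types = four_reflections_types[OF R facts(1,2) disjI2[OF sign_t] no_fix]
    have "m \<le> e" if e: "e > 0" "l ^ e = 1" for e
    proof (rule min[OF e(1)])
      \<comment> \<open>The swapped entries have product l^2, so their e-th powers are inverse to
        each other when \<open>l ^ e = 1\<close>.\<close>
      have "u i ^ e * u j ^ e = (l ^ e)\<^sup>2"
        using 2(7) by (metis power_commutes power_mult power_mult_distrib mult.commute)
      then have "transposition_reflection t (\<lambda>i. u i ^ e)"
        unfolding transposition_reflection_def using 2(1-6) e(2)
        by (intro exI[of _ i] exI[of _ j] exI[of _ k]) simp
      then show "t = id \<and> (\<forall>i<3. u i ^ e = 1) \<or> transposition_reflection t (\<lambda>i. u i ^ e)" ..
    qed
    moreover have lm: "l ^ m = 1"
      using u(2) 2(3,6) by auto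
    ultimately have order: "root_of_unity_of_order m l"
      by (intro l_order)
    define x where "x = (\<Prod>i<3. v1 i) * (\<Prod>i<3. v2 i) * (\<Prod>i<3. v3 i) * (\<Prod>i<3. v4 i)"
    have diag: "(\<Prod>i<3. v i) \<noteq> 1" if "diagonal_reflection s v" for s v
      by (rule diagonal_reflection_prod[OF that]) simp
    have "t \<noteq> id"
      using sign_t by auto
    \<comment> \<open>Exactly one of the four is diagonal and the other three products are 1, so x
      is the nontrivial entry of that diagonal reflection.\<close>
    then have x: "x \<noteq> 1" "\<And>f. x ^ f = 1 \<Longrightarrow> (\<Prod>i<3. v1 i) ^ f = 1 \<and> (\<Prod>i<3. v2 i) ^ f = 1 \<and> (\<Prod>i<3. v3 i) ^ f = 1 \<and>
        (\<Prod>i<3. v4 i) ^ f = 1"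
      using types unfolding x_def by (auto simp: transposition_reflection_prod diag)
    have xq: "x ^ q = 1"
      using dets by (simp add: x_def power_mult_distrib)
    have "(\<Prod>x<3. u x) = l ^ 3"
      unfolding prod_lessThan_3_distinct[OF 2(1-4), of u] 2(6,7) by (simp add: power3_eq_cube power2_eq_square)
    then have xl: "x * l ^ 3 = 1"
      using facts(3) by (simp add: x_def)
    have x_iff: "x ^ f = 1 \<longleftrightarrow> l ^ (3 * f) = 1" for f
    proof -
      have "x ^ f * l ^ (3 * f) = (x * l ^ 3) ^ f"
        by (simp add: power_mult_distrib power_mult)
      then have "x ^ f * l ^ (3 * f) = 1"
        unfolding xl by simp
      then show ?thesis
        by (metis mult.left_neutral mult.right_neutral)
    qed
    \<comment> \<open>\<open>x ^ q = 1\<close> means \<open>l ^ (3 * q) = 1\<close>, and l has order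
      m = p * q; dividing by q gives that p divides 3.\<close>
    have "m dvd 3 * q"
      using root_of_unity_of_order_dvd[OF order] xq x_iff by blast
    then have "p dvd 3"
      using pq by simp
    then have "p = 1 \<or> p = 3"
      using prime_nat_iff[of 3] by simp
    then show ?thesis
    proof
      assume "p = 1"
      \<comment> \<open>If m = 3 k, then already the k-th power of x is 1, so all products of
        entries in the group would be k-th roots of unity, whereas q = m of them occur.\<close>
      have "coprime m 3"
      proof (rule ccontr)
        assume "\<not> coprime m 3"
        then have "3 dvd m"
          using prime_imp_coprime[of "3 :: nat" m] by (auto simp: coprime_commute)
        then obtain k where k: "m = 3 * k"
          by blast
        then have "x ^ k = 1"
          using x_iff lm by simp
        moreover have "k > 0"
          using k m(1) by simp
        ultimately have "q \<le> k"
          using x(2) det_order by blast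
        with \<open>p = 1\<close> pq k \<open>k > 0\<close> show False by simp
      qed
      with order \<open>p = 1\<close> show ?thesis by simp
    next
      assume "p = 3"
      \<comment> \<open>For q = 1 the diagonal reflection would have entry x = 1 and be trivial;
        this is what excludes m = 3.\<close>
      moreover have "q \<noteq> 1"
        using xq x(1) by auto
      ultimately have "p = 3 \<and> (\<exists>k>1. m = 3 * k)"
        using pq by (intro conjI exI[of _ q]) auto
      with order show ?thesis by simp
    qed
  qed
qed

section \<open>Existence\<close>

definition entries :: "complex \<Rightarrow> complex \<Rightarrow> complex \<Rightarrow> nat \<Rightarrow> complex" where
  "entries a b c = (\<lambda>i. if i = 0 then a else if i = 1 then b else c)"

abbreviation "diag_mat_3 a b c \<equiv> monomial_mat 3 id (entries a b c)"
abbreviation "swap_01 x \<equiv> monomial_mat 3 (Transposition.transpose 0 1) (entries x (inverse x) 1)"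
abbreviation "swap_12 x \<equiv> monomial_mat 3 (Transposition.transpose 1 2) (entries 1 x (inverse x))"

lemma entries_nz: "a \<noteq> 0 \<Longrightarrow> b \<noteq> 0 \<Longrightarrow> c \<noteq> 0 \<Longrightarrow> entries a b c i \<noteq> 0"
  by (simp add: entries_def)

lemma monomial_mat_3_cong:
  "\<forall>i<3. s i = t i \<and> v i = w i \<Longrightarrow> monomial_mat 3 s v = monomial_mat 3 t w"
  by (intro monomial_mat_cong) auto

lemma permutes_swaps: "Transposition.transpose 0 1 permutes {..<3 :: nat}" "Transposition.transpose 1 2 permutes {..<3 :: nat}"
  by (simp_all add: permutes_swap_id)

lemmas mult_3 = monomial_mat_mult[OF permutes_id] permutes_swaps[THEN monomial_mat_mult]

lemma diag_mat_3_mult: "diag_mat_3 a b c * diag_mat_3 a' b' c' = diag_mat_3 (a * a') (b * b') (c * c')"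
  unfolding mult_3 by (rule monomial_mat_3_cong) (simp add: less_3_cases entries_def)

lemma swap_01_mult: "swap_01 1 * swap_01 x = diag_mat_3 (inverse x) x 1"
  unfolding mult_3 by (rule monomial_mat_3_cong) (simp add: less_3_cases entries_def)

lemma swap_01_conj: "swap_01 1 * diag_mat_3 a b c * swap_01 1 = diag_mat_3 b a c"
  unfolding mult_3 monomial_mat_mult[OF permutes_compose[OF permutes_swaps(1) permutes_id]]
  by (rule monomial_mat_3_cong) (simp add: less_3_cases entries_def)

lemma swap_12_conj: "swap_12 1 * diag_mat_3 a b c * swap_12 1 = diag_mat_3 a c b"
  unfolding mult_3 monomial_mat_mult[OF permutes_compose[OF permutes_swaps(2) permutes_id]]
  by (rule monomial_mat_3_cong) (simp add: less_3_cases entries_def)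

context
  fixes H :: "complex mat set"
  assumes H: "subgroup H (GL 3)"
    and s01: "swap_01 1 \<in> H" and s12: "swap_12 1 \<in> H"
begin

lemma mult_mem: "A \<in> H \<Longrightarrow> B \<in> H \<Longrightarrow> A * B \<in> H"
  using subgroup.m_closed[OF H] by (simp add: GL_simps)

lemma diag_swap_mem: "diag_mat_3 a b c \<in> H \<Longrightarrow> diag_mat_3 b a c \<in> H" "diag_mat_3 a b c \<in> H \<Longrightarrow> diag_mat_3 a c b \<in> H"
  using swap_01_conj[of a b c] swap_12_conj[of a b c] mult_mem s01 s12 by metis+

lemma diag_power_mem:
  assumes "diag_mat_3 a b c \<in> H"
  shows "diag_mat_3 (a ^ k) (b ^ k) (c ^ k) \<in> H"
proof (induction k)
  case 0
  have one: "diag_mat_3 (a ^ 0) (b ^ 0) (c ^ 0) = 1\<^sub>m 3"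
    unfolding monomial_mat_one by (rule monomial_mat_3_cong) (simp add: entries_def)
  show ?case
    unfolding one using subgroup.one_closed[OF H] by (simp add: GL_simps)
next
  case (Suc k)
  show ?case
    using mult_mem[OF assms Suc] unfolding diag_mat_3_mult power_Suc .
qed

text \<open>The adjacent transpositions generate all permutations of three points.\<close>

lemma permutation_mat_mem:
  assumes "s permutes {..<3}"
  shows "monomial_mat 3 s (\<lambda>i. 1) \<in> H"
proof -
  let ?P = "\<lambda>s. monomial_mat 3 s (\<lambda>i. 1 :: complex)"
  have one: "entries 1 (inverse 1) 1 = (\<lambda>i. 1)" "entries 1 1 (inverse 1) = (\<lambda>i. 1)"
    by (simp_all add: entries_def fun_eq_iff)
  have P: "?P (Transposition.transpose 0 1) \<in> H" "?P (Transposition.transpose 1 2) \<in> H"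
    using s01 s12 unfolding one .
  have comp: "?P (t \<circ> s) \<in> H" if "?P s \<in> H" "?P t \<in> H" "s permutes {..<3}" for s t
    using mult_mem[OF that(1,2)] unfolding monomial_mat_mult[OF that(3)] by simp
  \<comment> \<open>The missing transposition (0 2) is the conjugate of (1 2) by (0 1).\<close>
  have "?P (Transposition.transpose 0 1 \<circ> (Transposition.transpose 1 2 \<circ> Transposition.transpose 0 1)) \<in> H"
    by (intro comp P permutes_swaps permutes_compose)
  moreover have "Transposition.transpose 0 1 \<circ> (Transposition.transpose 1 2 \<circ> Transposition.transpose 0 1) =
      Transposition.transpose 0 (2 :: nat)"
    by (auto simp: fun_eq_iff Transposition.transpose_def)
  ultimately have P02: "?P (Transposition.transpose 0 2) \<in> H"
    by simp
  have transp: "?P (Transposition.transpose i j) \<in> H" if "i < 3" "j < 3" "i \<noteq> j" for i j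
    using that P P02 unfolding less_3_iff by (elim disjE) (simp_all add: transpose_commute)
  have non_cycle: "?P s \<in> H" if s: "s permutes {..<3}" "\<exists>i<3. s i = i" for s
    using s(1)
  proof (cases rule: permutes_3_cases)
    case 1
    then show ?thesis
      using subgroup.one_closed[OF H] by (simp add: GL_simps monomial_mat_one)
  next
    case (2 i j k)
    then show ?thesis
      using transp[of i j] by simp
  next
    case 3
    with s(2) show ?thesis by blast
  qed
  show ?thesis
  proof (cases "\<exists>i<3. s i = i")
    case False
    \<comment> \<open>A permutation without fixed point is an even 3-cycle, so composing it with a
      transposition gives a transposition, which is already covered.\<close>
    define t where "t = Transposition.transpose 0 1 \<circ> s"
    have t: "t permutes {..<3}"
      unfolding t_def using assms permutes_swaps(1) by (rule permutes_compose)
    have "s 0 < 3" "s 1 < 3" "s 2 < 3" "s 0 \<noteq> s 1" "s 0 \<noteq> s 2" "s 1 \<noteq> s 2"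
      using permutes_lessThan_less[OF assms] permutes_inj[OF assms] by (auto simp: inj_eq)
    then have "\<exists>i<3. t i = i"
      using False unfolding ex_less_3 t_def by (auto simp: less_3_iff)
    then have "?P t \<in> H"
      by (rule non_cycle[OF t])
    then have "?P (Transposition.transpose 0 1 \<circ> t) \<in> H"
      by (rule comp[OF _ P(1) t])
    moreover have "Transposition.transpose 0 1 \<circ> t = s"
      by (simp add: t_def fun_eq_iff)
    ultimately show ?thesis by simp
  qed (use non_cycle assms in blast)
qed

text \<open>Every diagonal matrix factors as diag(a, b, c) = diag(a, a^-1, 1) diag(1, ab, (ab)^-1)
  diag(1, 1, abc). The first two factors come from \<open>dz\<close> by powers and conjugation with
  permutation matrices. Only the last one involves p.\<close>

lemma G_imprim_subset_subgroup:
  assumes m: "m > 0" and z: "\<And>x. x ^ m = 1 \<Longrightarrow> \<exists>k. x = z ^ k"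
    and dz: "diag_mat_3 z (inverse z) 1 \<in> H"
    and det: "\<And>y. y ^ (m div p) = 1 \<Longrightarrow> diag_mat_3 1 1 y \<in> H"
  shows "G_imprim m p 3 \<subseteq> H"
proof
  fix A assume "A \<in> G_imprim m p 3"
  then obtain s v where A: "A = monomial_mat 3 s v" and s: "s permutes {..<3}" and v: "\<forall>i<3. v i \<noteq> 0" "\<forall>i<3. v i ^ m = 1"
    "(\<Prod>i<3. v i) ^ (m div p) = 1"
    by (rule G_imprimE)
  have d1: "diag_mat_3 x (inverse x) 1 \<in> H" if x: "x ^ m = 1" for x
  proof -
    obtain k where "x = z ^ k"
      using z[OF x] by blast
    then show ?thesis
      using diag_power_mem[OF dz, of k] by (simp add: power_inverse)
  qed
  have d2: "diag_mat_3 1 x (inverse x) \<in> H" if "x ^ m = 1" for x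
    using diag_swap_mem(1)[OF diag_swap_mem(2)[OF d1[OF that]]] .
  have "diag_mat_3 (v 0) (inverse (v 0)) 1 \<in> H"
    using v(2) by (intro d1) simp
  moreover have "diag_mat_3 1 (v 0 * v 1) (inverse (v 0 * v 1)) \<in> H"
    using v(2) by (intro d2) (simp add: power_mult_distrib)
  moreover have "diag_mat_3 1 1 (v 0 * v 1 * v 2) \<in> H"
    using v(3) by (intro det) (simp add: prod_lessThan_3)
  ultimately have mem: "diag_mat_3 (v 0) (inverse (v 0)) 1 * diag_mat_3 1 (v 0 * v 1) (inverse (v 0 * v 1)) *
      diag_mat_3 1 1 (v 0 * v 1 * v 2) \<in> H"
    by (intro mult_mem)
  have "v 0 \<noteq> 0" "v 1 \<noteq> 0"
    using v(1) by simp_all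
  then have eqs: "v 0 * 1 * 1 = v 0" "inverse (v 0) * (v 0 * v 1) * 1 = v 1"
    "1 * inverse (v 0 * v 1) * (v 0 * v 1 * v 2) = v 2"
    by (simp_all add: field_simps)
  have "diag_mat_3 (v 0) (v 1) (v 2) \<in> H"
    using mem unfolding diag_mat_3_mult eqs .
  then have "diag_mat_3 (v 0) (v 1) (v 2) * monomial_mat 3 s (\<lambda>i. 1) \<in> H"
    using permutation_mat_mem[OF s] by (rule mult_mem)
  also have "diag_mat_3 (v 0) (v 1) (v 2) * monomial_mat 3 s (\<lambda>i. 1) = A"
    unfolding mult_3 A by (rule monomial_mat_3_cong) (simp add: less_3_cases entries_def)
  finally show "A \<in> H" .
qed

end

section \<open>Membership, reflections and criteria for niceness\<close>

lemma swap_01_reflection: "x \<noteq> 0 \<Longrightarrow> is_reflection 3 (swap_01 x)"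
  by (rule transposition_reflection_is_reflection, unfold transposition_reflection_def)
    (intro exI[of _ 0] exI[of _ 1] exI[of _ 2], simp add: entries_def)

lemma swap_12_reflection: "x \<noteq> 0 \<Longrightarrow> is_reflection 3 (swap_12 x)"
  by (rule transposition_reflection_is_reflection, unfold transposition_reflection_def)
    (intro exI[of _ 1] exI[of _ 2] exI[of _ 0], simp add: entries_def)

lemma diag_mat_3_reflection: "x \<noteq> 1 \<Longrightarrow> x ^ m = 1 \<Longrightarrow> m > 0 \<Longrightarrow> is_reflection 3 (diag_mat_3 1 1 x)"
  by (rule diagonal_reflection_is_reflection[of _ _ m], unfold diagonal_reflection_def)
    (auto simp: entries_def less_3_cases intro!: exI[of _ 2])

lemma swap_mem_G_imprim:
  assumes "x ^ m = 1" "m > 0"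
  shows "swap_01 x \<in> G_imprim m p 3" "swap_12 x \<in> G_imprim m p 3"
proof -
  have "x \<noteq> 0"
    using assms by (auto simp: power_0_left)
  with assms show "swap_01 x \<in> G_imprim m p 3" "swap_12 x \<in> G_imprim m p 3"
    by (auto intro!: G_imprimI permutes_swap_id simp: less_3_cases prod_lessThan_3 entries_def power_inverse)
qed

lemma diag_mem_G_imprim:
  assumes "x ^ (m div p) = 1" "m > 0" "p dvd m"
  shows "diag_mat_3 1 1 x \<in> G_imprim m p 3"
proof -
  have "x ^ m = (x ^ (m div p)) ^ p"
    using assms(3) by (simp flip: power_mult)
  then have "x ^ m = 1"
    using assms(1) by simp
  with assms show ?thesis
    by (auto intro!: G_imprimI permutes_id simp: less_3_cases prod_lessThan_3 entries_def)
qed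

text \<open>Generation is stated through an arbitrary subgroup H containing the tuple, so that a
  witness is checked by closure properties alone; H is then taken to be the generated
  subgroup.\<close>

lemma nice_tupleI:
  assumes "length As = T" "\<And>A. A \<in> set As \<Longrightarrow> A \<in> G_imprim m p n \<and> is_reflection n A"
    and "\<And>H. subgroup H (GL n) \<Longrightarrow> set As \<subseteq> H \<Longrightarrow> G_imprim m p n \<subseteq> H" and "mc_parameter n As l"
  shows "nice_tuple n T (G_imprim m p n) As"
proof -
  have As: "set As \<subseteq> G_imprim m p n"
    using assms(2) by blast
  then have "set As \<subseteq> carrier (GL n)"
    using subgroup.subset[OF subgroup_G_imprim] by blast
  then have "subgroup (generate (GL n) (set As)) (GL n)"
    by (rule group.generate_is_subgroup[OF group_GL])
  then have "G_imprim m p n \<subseteq> generate (GL n) (set As)"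
    by (rule assms(3)) (auto intro: generate.incl)
  moreover have "generate (GL n) (set As) \<subseteq> G_imprim m p n"
    using group.generate_subgroup_incl[OF group_GL As subgroup_G_imprim] .
  ultimately show ?thesis
    using assms(1,2,4) by (auto simp: nice_tuple_def)
qed

lemma mc_parameterI:
  assumes "foldr (*) As (1\<^sub>m 3) = monomial_mat 3 s v" "s permutes {..<3}" "\<forall>i<3. v i \<noteq> 0"
    and "char_roots (monomial_mat 3 (inv_into UNIV s) (monomial_inv s v)) a b c"
    and "l \<noteq> 1" "l = a \<or> l = b \<or> l = c"
    "of_bool (l = a) + of_bool (l = b) + of_bool (l = c) + 2 = length As"
  shows "mc_parameter 3 As l"
proof -
  have "(\<otimes>\<^bsub>GL 3\<^esub>) = (*)"
    by (simp add: fun_eq_iff GL_simps)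
  then show ?thesis
    using assms unfolding mc_parameter_def
    by (simp add: GL_simps GL_inv_monomial_mat char_roots_eigenvalue char_roots_multiplicity)
qed

section \<open>Explicit nice tuples\<close>

lemma diag_mem_of_swaps:
  assumes "subgroup H (GL 3)" "swap_01 1 \<in> H" "swap_12 1 \<in> H" "swap_01 (inverse z) \<in> H"
  shows "diag_mat_3 z (inverse z) 1 \<in> H"
  using mult_mem[OF assms(1-3,2,4)] unfolding swap_01_mult unfolding inverse_inverse_eq .

lemma G_imprim_m_m_subset_subgroup:
  assumes H: "subgroup H (GL 3)" "swap_01 1 \<in> H" "swap_12 1 \<in> H" "swap_01 (inverse z) \<in> H"
    and z: "root_of_unity_of_order m z" "\<And>x. x ^ m = 1 \<Longrightarrow> \<exists>k. x = z ^ k" and m: "m > 0"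
  shows "G_imprim m m 3 \<subseteq> H"
proof (rule G_imprim_subset_subgroup[OF H(1-3) m z(2) diag_mem_of_swaps[OF H]])
  fix y :: complex
  assume "y ^ (m div m) = 1"
  then have "y = z ^ 0"
    using m by simp
  then show "diag_mat_3 1 1 y \<in> H"
    using diag_power_mem[OF H(1-3) diag_mem_of_swaps[OF H], of 0] unfolding power_0 by simp
qed

text \<open>For T = 3 a simple eigenvalue other than 1 suffices. The product is a 3-cycle matrix, so
  its inverse has three distinct eigenvalues, all with cube z^-1 \<noteq> 1, and any of them
  serves.\<close>

lemma nice_triple_G_m_1:
  assumes "m > 1"
  shows "\<exists>As. nice_tuple 3 3 (G_imprim m 1 3) As"
proof -
  have m: "m > 0"
    using assms by simp
  obtain z where z: "root_of_unity_of_order m z" "\<And>x. x ^ m = 1 \<Longrightarrow> \<exists>k. x = z ^ k"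
    using primitive_root_exists[OF m] by blast
  have zm: "z ^ m = 1" "z \<noteq> 1" "z \<noteq> 0"
    using z(1) assms by (auto simp: root_of_unity_of_order_def power_0_left dest: spec[of _ 1])
  let ?As = "[swap_01 1, swap_12 1, diag_mat_3 1 1 z]"
  define s where "s = Transposition.transpose 1 2 \<circ> Transposition.transpose 0 (1 :: nat)"
  have s: "s permutes {..<3}"
    unfolding s_def using permutes_swaps by (rule permutes_compose)
  define v where "v = entries z 1 1"
  have v: "\<forall>i<3. v i \<noteq> 0"
    using zm by (simp add: v_def entries_nz)
  have "foldr (*) ?As (1\<^sub>m 3) = monomial_mat 3 s v"
    unfolding foldr.simps comp_apply id_apply s_def v_def monomial_mat_one mult_3
    by (rule monomial_mat_3_cong) (simp add: less_3_cases entries_def)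
  moreover have "\<forall>i<3. inv_into UNIV s i \<noteq> i"
    using permutes_inv_eq[OF s] by (simp add: less_3_cases s_def)
  then obtain a b c where cr: "char_roots (monomial_mat 3 (inv_into UNIV s) (monomial_inv s v)) a b c"
    and d: "distinct [a, b, c]" and a: "a ^ 3 = monomial_inv s v 0 * monomial_inv s v 1 * monomial_inv s v 2"
    using char_roots_cycle_distinct[OF permutes_inv[OF s]] monomial_inv_nonzero[OF s, of v] v by metis
  have "a ^ 3 = inverse z"
    using prod_monomial_inv[OF s, of v] unfolding a prod_lessThan_3 by (simp add: v_def entries_def)
  then have "a \<noteq> 1"
    using zm by auto
  ultimately have mc: "mc_parameter 3 ?As a"
    using s v cr d by (intro mc_parameterI[of _ s v a b c]) auto
  have "nice_tuple 3 3 (G_imprim m 1 3) ?As"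
  proof (rule nice_tupleI[OF _ _ _ mc])
    show "A \<in> G_imprim m 1 3 \<and> is_reflection 3 A" if "A \<in> set ?As" for A
      using that zm m swap_mem_G_imprim[of 1 m 1] diag_mem_G_imprim[of z m 1]
        swap_01_reflection[of 1] swap_12_reflection[of 1] diag_mat_3_reflection[of z m] by auto
    fix H assume H: "subgroup H (GL 3)" "set ?As \<subseteq> H"
    then have mem: "swap_01 1 \<in> H" "swap_12 1 \<in> H" "diag_mat_3 1 1 z \<in> H"
      by simp_all
    note mult = mult_mem[OF H(1) mem(1,2)] and sw = diag_swap_mem[OF H(1) mem(1,2)]
      and pow = diag_power_mem[OF H(1) mem(1,2)]
    have "inverse z = z ^ (m - 1)"
      using zm m by (simp add: inverse_eq_divide power_diff)
    then have "diag_mat_3 1 1 (inverse z) \<in> H"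
      using pow[OF mem(3), of "m - 1"] unfolding power_one by metis
    \<comment> \<open>Both factors are conjugates under permutation matrices of diag(1, 1, z) and
      its inverse.\<close>
    then have "diag_mat_3 z 1 1 * diag_mat_3 1 (inverse z) 1 \<in> H"
      using mult[OF sw(1)[OF sw(2)[OF mem(3)]] sw(2)] by blast
    then have "diag_mat_3 z (inverse z) 1 \<in> H"
      unfolding diag_mat_3_mult mult_1_left mult_1_right .
    moreover have "diag_mat_3 1 1 y \<in> H" if y: "y ^ (m div 1) = 1" for y
    proof -
      obtain k where "y = z ^ k"
        using z(2)[of y] y by auto
      then show ?thesis
        using pow[OF mem(3), of k] unfolding power_one by metis
    qed
    ultimately show "G_imprim m 1 3 \<subseteq> H"
      by (intro G_imprim_subset_subgroup[OF H(1) mem(1,2) m z(2)])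
  qed simp
  then show ?thesis ..
qed

text \<open>The first two matrices supply diag(z, z^-1, 1), needed for generation. The inverse
  product has eigenvalues r, -r, z^-1 with r^2 = z, and neither r nor -r is 1 because z \<noteq>
  1.\<close>

lemma nice_triple_G_m_m:
  assumes "m > 1"
  shows "\<exists>As. nice_tuple 3 3 (G_imprim m m 3) As"
proof -
  have m: "m > 0"
    using assms by simp
  obtain z where z: "root_of_unity_of_order m z" "\<And>x. x ^ m = 1 \<Longrightarrow> \<exists>k. x = z ^ k"
    using primitive_root_exists[OF m] by blast
  have zm: "z ^ m = 1" "z \<noteq> 1" "z \<noteq> 0"
    using z(1) assms by (auto simp: root_of_unity_of_order_def power_0_left dest: spec[of _ 1])
  let ?x = "inverse z"
  have x: "?x ^ m = 1" "?x \<noteq> 0"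
    using zm by (simp_all add: power_inverse)
  let ?As = "[swap_01 1, swap_01 ?x, swap_12 1]"
  let ?s = "Transposition.transpose 1 (2 :: nat)"
  have prod: "foldr (*) ?As (1\<^sub>m 3) = monomial_mat 3 ?s (entries z ?x 1)"
    unfolding foldr.simps comp_apply id_apply monomial_mat_one mult_3
    by (rule monomial_mat_3_cong) (simp add: less_3_cases entries_def)
  have inv: "monomial_mat 3 (inv_into UNIV ?s) (monomial_inv ?s (entries z ?x 1)) =
      monomial_mat 3 ?s (entries ?x 1 z)"
    by (rule monomial_mat_3_cong) (simp add: less_3_cases entries_def monomial_inv_def)
  obtain r where r: "r \<noteq> 0" "r\<^sup>2 = z" and cr: "char_roots (monomial_mat 3 ?s (entries ?x 1 z)) r (- r) ?x"
    using char_roots_transpose_ex[of 1 2 0 "entries ?x 1 z"] zm by (auto simp: entries_def)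
  have r1: "r \<noteq> 1" "- r \<noteq> 1" "r \<noteq> - r"
    using r zm by (auto simp: eq_neg_iff_add_eq_0 minus_equation_iff[of r])
  \<comment> \<open>At most one of r and -r coincides with z^-1; the other one is a simple
    eigenvalue.\<close>
  define l where "l = (if r = ?x then - r else r)"
  have "mc_parameter 3 ?As l"
    using r1 zm by (intro mc_parameterI[OF prod permutes_swaps(2) _ cr[folded inv]]) (auto simp: l_def entries_nz)
  then have "nice_tuple 3 3 (G_imprim m m 3) ?As"
  proof (rule nice_tupleI[rotated 3])
    show "A \<in> G_imprim m m 3 \<and> is_reflection 3 A" if "A \<in> set ?As" for A
      using that zm x m swap_mem_G_imprim[of 1 m m] swap_mem_G_imprim[of ?x m m]
        swap_01_reflection[of 1] swap_01_reflection[of ?x] swap_12_reflection[of 1] by auto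
    fix H assume H: "subgroup H (GL 3)" "set ?As \<subseteq> H"
    then have mem: "swap_01 1 \<in> H" "swap_12 1 \<in> H" "swap_01 ?x \<in> H"
      by simp_all
    show "G_imprim m m 3 \<subseteq> H"
      using H(1) mem z m by (rule G_imprim_m_m_subset_subgroup)
  qed simp
  then show ?thesis ..
qed

lemma nice_quadruple_G_m_m:
  assumes "m > 1" "m \<noteq> 3"
  shows "\<exists>As. nice_tuple 3 4 (G_imprim m m 3) As"
proof -
  have m: "m > 0"
    using assms by simp
  obtain z where z: "root_of_unity_of_order m z" "\<And>x. x ^ m = 1 \<Longrightarrow> \<exists>k. x = z ^ k"
    using primitive_root_exists[OF m] by blast
  have zm: "z ^ m = 1" "z \<noteq> 1" "z \<noteq> 0"
    using z(1) assms by (auto simp: root_of_unity_of_order_def power_0_left dest: spec[of _ 1])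
  have "z ^ 3 \<noteq> 1"
  proof
    assume "z ^ 3 = 1"
    then have "m dvd 3"
      by (rule root_of_unity_of_order_dvd[OF z(1)])
    then show False
      using assms prime_nat_iff[of 3] by auto
  qed
  then have z3: "z\<^sup>2 \<noteq> inverse z"
    using zm by (auto simp: power2_eq_square power3_eq_cube field_simps)
  let ?x = "inverse z"
  have x: "?x ^ m = 1" "?x \<noteq> 0" "?x \<noteq> 1"
    using zm by (simp_all add: power_inverse)
  \<comment> \<open>The pairs multiply to diag(z, z^-1, 1) and diag(1, z^-1, z), which together give
    diag(z, z^-2, z). The double eigenvalue of the inverse is z^-1, and it is not triple because z^3
    \<noteq> 1.\<close>
  let ?As = "[swap_01 1, swap_01 ?x, swap_12 1, swap_12 z]"
  have prod: "foldr (*) ?As (1\<^sub>m 3) = monomial_mat 3 id (entries z (?x * ?x) z)"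
    unfolding foldr.simps comp_apply id_apply monomial_mat_one mult_3
    by (rule monomial_mat_3_cong) (simp add: less_3_cases entries_def)
  have inv: "monomial_mat 3 (inv_into UNIV id) (monomial_inv id (entries z (?x * ?x) z)) =
      monomial_mat 3 id (entries ?x (z\<^sup>2) ?x)"
    by (rule monomial_mat_3_cong) (simp add: less_3_cases entries_def monomial_inv_def power2_eq_square)
  have cr: "char_roots (monomial_mat 3 id (entries ?x (z\<^sup>2) ?x)) ?x (z\<^sup>2) ?x"
    using char_roots_diagonal[of "entries ?x (z\<^sup>2) ?x"] by (simp add: entries_def)
  have "mc_parameter 3 ?As ?x"
    using zm x z3 by (intro mc_parameterI[OF prod permutes_id _ cr[folded inv]]) (auto simp: entries_nz)
  then have "nice_tuple 3 4 (G_imprim m m 3) ?As"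
  proof (rule nice_tupleI[rotated 3])
    show "A \<in> G_imprim m m 3 \<and> is_reflection 3 A" if "A \<in> set ?As" for A
      using that zm x m swap_mem_G_imprim[of 1 m m] swap_mem_G_imprim[of ?x m m] swap_mem_G_imprim[of z m m]
        swap_01_reflection[of 1] swap_01_reflection[of ?x] swap_12_reflection[of 1] swap_12_reflection[of z] by auto
    fix H assume H: "subgroup H (GL 3)" "set ?As \<subseteq> H"
    then have mem: "swap_01 1 \<in> H" "swap_12 1 \<in> H" "swap_01 ?x \<in> H"
      by simp_all
    show "G_imprim m m 3 \<subseteq> H"
      using H(1) mem z m by (rule G_imprim_m_m_subset_subgroup)
  qed simp
  then show ?thesis ..
qed

text \<open>Cubing is bijective on m-th roots of unity when 3 does not divide m, and has the
  (m/3)-th roots as its image when it does. Thus z^3 generates the (m/p)-th roots in both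
  cases.\<close>

lemma roots_of_unity_powers_cube:
  assumes m: "m > 1" and p: "p = 1 \<and> coprime m 3 \<or> p = 3 \<and> (\<exists>k. m = 3 * k)"
    and z: "root_of_unity_of_order m z" "\<And>x. x ^ m = 1 \<Longrightarrow> \<exists>k. x = z ^ k"
    and y: "y ^ (m div p) = 1"
  shows "\<exists>k. y = (z ^ 3) ^ k"
  using p
proof
  assume p: "p = 1 \<and> coprime m 3"
  then obtain k where k: "y = z ^ k"
    using z(2) y by auto
  \<comment> \<open>With x an inverse of 3 modulo m, the root z is itself a power of its
    cube.\<close>
  obtain x where "[3 * x = 1] (mod m)"
    using p cong_solve_coprime_nat[of 3 m] by (auto simp: coprime_commute)
  then have "(3 * x) mod m = 1"
    using m by (simp add: cong_def)
  then have "3 * x = m * (3 * x div m) + 1"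
    using mult_div_mod_eq[of m "3 * x"] by simp
  then have "z ^ (3 * x) = (z ^ m) ^ (3 * x div m) * z"
    by (metis power_add power_mult power_one_right)
  then have "z ^ (3 * x) = z"
    using z(1) by (simp add: root_of_unity_of_order_def)
  then have "y = (z ^ 3) ^ (x * k)"
    using k by (simp add: power_mult)
  then show ?thesis ..
next
  assume p: "p = 3 \<and> (\<exists>k. m = 3 * k)"
  then obtain q where q: "m = 3 * q" "q > 0" "m div p = q"
    using m by auto
  have "y ^ m = 1"
    using y q by (simp add: power_mult mult.commute)
  then obtain k where k: "y = z ^ k"
    using z(2) by blast
  then have "z ^ (k * q) = 1"
    using y q by (simp add: power_mult)
  \<comment> \<open>Since m = 3 q, this says that 3 divides k.\<close>
  then have "m dvd k * q"
    by (rule root_of_unity_of_order_dvd[OF z(1)])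
  then obtain j where "k = 3 * j"
    using q by auto
  then have "y = (z ^ 3) ^ j"
    using k by (simp add: power_mult)
  then show ?thesis ..
qed

text \<open>The diagonal entry z^3 is forced. The first three matrices leave z on the fixed
  coordinate and z^-1, 1 on the swapped pair, and multiplication of z^-1 by z^3 makes the swapped
  entries have product z^2. The inverse product then has eigenvalues z^-1, -z^-1, z^-1.\<close>

lemma nice_quadruple_G_m_p:
  assumes "m > 1" and p: "p = 1 \<and> coprime m 3 \<or> p = 3 \<and> (\<exists>k>1. m = 3 * k)"
  shows "\<exists>As. nice_tuple 3 4 (G_imprim m p 3) As"
proof -
  have m: "m > 0" "p dvd m"
    using assms by auto
  have "m \<noteq> 3"
    using p by auto
  obtain z where z: "root_of_unity_of_order m z" "\<And>x. x ^ m = 1 \<Longrightarrow> \<exists>k. x = z ^ k"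
    using primitive_root_exists[OF m(1)] by blast
  have zm: "z ^ m = 1" "z \<noteq> 1" "z \<noteq> 0"
    using z(1) assms by (auto simp: root_of_unity_of_order_def power_0_left dest: spec[of _ 1])
  have z3: "z ^ 3 \<noteq> 1"
  proof
    assume "z ^ 3 = 1"
    then have "m dvd 3"
      by (rule root_of_unity_of_order_dvd[OF z(1)])
    then show False
      using assms(1) \<open>m \<noteq> 3\<close> prime_nat_iff[of 3] by auto
  qed
  have z3q: "(z ^ 3) ^ (m div p) = 1" "(z ^ 3) ^ m = 1"
  proof -
    \<comment> \<open>For p = 3 the exponent 3 (m/p) is m itself, for p = 1 it is 3 m; both
      annihilate z.\<close>
    have "3 * (m div p) = m \<or> p = 1"
      using p by auto
    then show "(z ^ 3) ^ (m div p) = 1"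
      using zm(1) by (metis div_by_1 power_mult power_one mult.commute)
    show "(z ^ 3) ^ m = 1"
      using zm(1) by (metis mult.commute power_mult power_one)
  qed
  let ?x = "inverse z"
  have x: "?x ^ m = 1" "?x \<noteq> 0" "?x \<noteq> 1"
    using zm by (simp_all add: power_inverse)
  let ?As = "[swap_01 1, swap_01 ?x, swap_12 1, diag_mat_3 1 1 (z ^ 3)]"
  let ?s = "Transposition.transpose 1 (2 :: nat)"
  have prod: "foldr (*) ?As (1\<^sub>m 3) = monomial_mat 3 ?s (entries z (z\<^sup>2) 1)"
    unfolding foldr.simps comp_apply id_apply monomial_mat_one mult_3
    using zm by (intro monomial_mat_3_cong)
      (simp add: less_3_cases entries_def power2_eq_square power3_eq_cube)
  have inv: "monomial_mat 3 (inv_into UNIV ?s) (monomial_inv ?s (entries z (z\<^sup>2) 1)) =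
      monomial_mat 3 ?s (entries ?x 1 (?x\<^sup>2))"
    by (rule monomial_mat_3_cong) (simp add: less_3_cases entries_def monomial_inv_def power_inverse)
  have cr: "char_roots (monomial_mat 3 ?s (entries ?x 1 (?x\<^sup>2))) ?x (- ?x) ?x"
    using char_roots_transpose[of 1 2 0 ?x "entries ?x 1 (?x\<^sup>2)"] by (simp add: entries_def)
  have "?x \<noteq> - ?x"
    using zm by simp
  then have "mc_parameter 3 ?As ?x"
    using zm x by (intro mc_parameterI[OF prod permutes_swaps(2) _ cr[folded inv]]) (auto simp: entries_nz)
  then have "nice_tuple 3 4 (G_imprim m p 3) ?As"
  proof (rule nice_tupleI[rotated 3])
    show "A \<in> G_imprim m p 3 \<and> is_reflection 3 A" if "A \<in> set ?As" for A
      using that x m z3 z3q swap_mem_G_imprim[of 1 m p] swap_mem_G_imprim[of ?x m p] diag_mem_G_imprim[of "z ^ 3" m p]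
        swap_01_reflection[of 1] swap_01_reflection[of ?x] swap_12_reflection[of 1] diag_mat_3_reflection[of "z ^ 3" m]
      by auto
    fix H assume H: "subgroup H (GL 3)" "set ?As \<subseteq> H"
    then have mem: "swap_01 1 \<in> H" "swap_12 1 \<in> H" "swap_01 ?x \<in> H" "diag_mat_3 1 1 (z ^ 3) \<in> H"
      by simp_all
    have "diag_mat_3 1 1 y \<in> H" if y: "y ^ (m div p) = 1" for y
    proof -
      obtain k where "y = (z ^ 3) ^ k"
        using roots_of_unity_powers_cube[OF assms(1) _ z y] p by blast
      then show ?thesis
        using diag_power_mem[OF H(1) mem(1,2,4), of k] unfolding power_one by metis
    qed
    then show "G_imprim m p 3 \<subseteq> H"
      using G_imprim_subset_subgroup[OF H(1) mem(1,2) m(1) z(2)] diag_mem_of_swaps[OF H(1) mem(1,2,3)] by blast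
  qed simp
  then show ?thesis ..
qed

theorem theorem1p5:
  fixes m p :: nat
  assumes "m > 1" and "p dvd m"
  shows "(p \<notin> {1, m} \<longrightarrow> \<not> (\<exists>As. nice_tuple 3 3 (G_imprim m p 3) As)) \<and>
         (\<exists>As. nice_tuple 3 3 (G_imprim m 1 3) As) \<and>
         (\<exists>As. nice_tuple 3 3 (G_imprim m m 3) As) \<and>
         ((\<exists>As. nice_tuple 3 4 (G_imprim m p 3) As) \<longleftrightarrow>
            (p = m \<and> m \<noteq> 3) \<or>
            (p = 1 \<and> coprime m 3) \<or>
            (p = 3 \<and> (\<exists>k>1. m = 3 * k))) \<and>
         ((p = m \<and> m \<noteq> 3) \<or>
          (p = 1 \<and> coprime m 3) \<or>
          (p = 3 \<and> (\<exists>k>1. m = 3 * k)) \<longrightarrow>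
            (\<forall>As l. nice_tuple 3 4 (G_imprim m p 3) As \<and> mc_parameter 3 As l \<longrightarrow>
                    root_of_unity_of_order m l))"
proof -
  have m: "m > 0"
    using assms(1) by simp
  have quad: "root_of_unity_of_order m l \<and>
      (p = m \<and> m \<noteq> 3 \<or> p = 1 \<and> coprime m 3 \<or> p = 3 \<and> (\<exists>k>1. m = 3 * k))"
    if "nice_tuple 3 4 (G_imprim m p 3) As" "mc_parameter 3 As l" for As l
    using nice_quadruple[OF that m assms(2)] .
  have "p = m \<and> m \<noteq> 3 \<or> p = 1 \<and> coprime m 3 \<or> p = 3 \<and> (\<exists>k>1. m = 3 * k)"
    if nice: "nice_tuple 3 4 (G_imprim m p 3) As" for As
  proof -
    obtain l where "mc_parameter 3 As l"
      using nice by (auto simp: nice_tuple_def)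
    then show ?thesis
      using quad[OF nice] by blast
  qed
  moreover have "\<exists>As. nice_tuple 3 4 (G_imprim m p 3) As"
    if "p = m \<and> m \<noteq> 3 \<or> p = 1 \<and> coprime m 3 \<or> p = 3 \<and> (\<exists>k>1. m = 3 * k)"
    using that nice_quadruple_G_m_m[OF assms(1)] nice_quadruple_G_m_p[OF assms(1), of p] by blast
  moreover have "\<not> (\<exists>As. nice_tuple 3 3 (G_imprim m p 3) As)" if "p \<notin> {1, m}"
    using no_nice_triple[OF _ m assms(2)] that by blast
  ultimately show ?thesis
    using nice_triple_G_m_1[OF assms(1)] nice_triple_G_m_m[OF assms(1)] quad by blast
qed

end
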